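(* Let $q$ be a prime power and let $n\ge3$ be odd. Let $U$ be a subset of $H_n(\mathbb{F}_{q^2})$ such that $\mathrm{rank}(x-y)\le 2$ for all $x,y\in U$. Then $|U|\le q^{2n-1}+q^n-q^{n-1}$, and if equality holds, then for every $A\in U$ the set $\{A-B : B\in U\}$ is a constant rank-distance $2$ set.
   Context: $H_n(\mathbb{F}_{q^2})$ is the set of $n\times n$ hermitian matrices over $\mathbb{F}_{q^2}$ (matrices $A$ with $\overline{A}^T=A$, $\overline{\cdot}$ being $x\mapsto x^q$ entrywise). A constant rank-distance $k$ set is a set $U$ of $n\times n$ matrices with $\mathrm{rank}(A-B)=k$ for all distinct $A,B\in U$ and $\mathrm{rank}(A)=k$ for all nonzero $A\in U$. *)

theory Defs
  imports "HOL-Library.Cardinality" "Jordan_Normal_Form.DL_Rank" "HOL-Number_Theory.Prime_Powers"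
begin

text \<open>
  The field with \<open>q\<^sup>2\<close> elements is rendered as an arbitrary finite field type of cardinality
  \<open>q\<^sup>2\<close>; on it the involution \<open>x \<mapsto> x\<^sup>q\<close> is the conjugation over the subfield of order \<open>q\<close>.
  The parameter \<open>q\<close> is explicit because the type does not determine it syntactically.
\<close>

definition conj_transpose :: "nat \<Rightarrow> 'a::field mat \<Rightarrow> 'a mat" where
  "conj_transpose q A = transpose_mat (map_mat (\<lambda>x. x ^ q) A)"

definition hermitian_mats :: "nat \<Rightarrow> nat \<Rightarrow> 'a::field mat set" where
  "hermitian_mats n q = {A \<in> carrier_mat n n. conj_transpose q A = A}"

text \<open>
  In \<open>vec_space.rank n A\<close> the argument \<open>n\<close> is the number of rows of \<open>A\<close>.
\<close>

definition constant_rank_distance_set :: "nat \<Rightarrow> nat \<Rightarrow> 'a::field mat set \<Rightarrow> bool" where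
  "constant_rank_distance_set n k U \<longleftrightarrow>
     U \<subseteq> carrier_mat n n \<and>
     (\<forall>A\<in>U. \<forall>B\<in>U. A \<noteq> B \<longrightarrow> vec_space.rank n (A - B) = k) \<and>
     (\<forall>A\<in>U. A \<noteq> 0\<^sub>m n n \<longrightarrow> vec_space.rank n A = k)"

end

theory Submission
  imports Defs "HOL-Number_Theory.Residues"
begin

text \<open>
  Pair the elements of \<open>U\<close> with random functionals: for invertible \<open>g\<close>, the map
  \<open>A \<mapsto> tr (g A g\<^sup>*)\<close> is additive from Hermitian matrices to the subfield \<open>K\<close> of order \<open>q\<close>.
  With \<open>psi\<close> the sum of the nontrivial characters of \<open>K\<close>, the sum of \<open>psi (tr (g (x - y) g\<^sup>*))\<close>
  over \<open>x, y \<in> U\<close> is nonnegative. Since \<open>GL\<^sub>n\<close> is transitive on nonzero vectors and on independent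
  pairs, the average over \<open>g\<close> depends only on the rank of \<open>x - y\<close>: for \<open>n\<close> odd and ranks
  \<open>0, 1, 2\<close> it is \<open>q - 1\<close> times \<open>1\<close>, \<open>-1 / (q\<^sup>n - 1)\<close> and \<open>-1 / D\<close>,
  where \<open>D = (q\<^sup>n - 1) (q\<^bsup>n-1\<^esup> + 1)\<close>. Hence \<open>card U \<le> D + 1\<close>, and in case of equality
  no difference has rank \<open>1\<close>, as its average lies strictly below \<open>-(q - 1) / D\<close>.
\<close>

section \<open>Conjugation on the finite field\<close>

lemma field_power_card:
  fixes x :: "'a::{field,finite}"
  shows "x ^ CARD('a) = x"
proof (cases "x = 0")
  case False
  \<comment> \<open>Multiplication by \<open>x\<close> permutes the nonzero elements; cancelling
    their product leaves \<open>x ^ (CARD('a) - 1) = 1\<close>.\<close>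
  have "(\<Prod>y\<in>UNIV - {0}. x * y) = (\<Prod>y\<in>UNIV - {0}. y)"
    by (rule prod.reindex_bij_witness[of _ "\<lambda>y. y / x" "\<lambda>y. x * y"]) (use False in auto)
  hence "x ^ (CARD('a) - 1) = 1"
    by (simp add: prod.distrib card_Diff_singleton)
  thus ?thesis
    by (metis finite_UNIV_card_ge_0 finite_class.finite_UNIV mult.right_neutral power_minus_mult
        mult.commute)
qed simp

lemma card_roots_le:
  fixes p :: "'a::field poly"
  assumes "p \<noteq> 0" "Polynomial.degree p \<le> d"
  shows "card {x. poly p x = 0} \<le> d"
  using card_poly_roots_bound[OF assms(1)] assms(2) by linarith

locale conj_field =
  fixes q :: nat and ty :: "'a::{field,finite} itself"
  assumes q_primepow: "primepow q" and card_field: "CARD('a) = q ^ 2"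
begin

definition fixed_field :: "'a set" where
  "fixed_field = {x. x ^ q = x}"

lemma q_gt_1: "q > 1"
  using q_primepow primepow_gt_Suc_0 by auto

text \<open>This makes \<open>x \<mapsto> x ^ q\<close> additive through the freshman's dream. The
  characteristic divides the order of the field, a power of the prime below \<open>q\<close>, and so
  equals that prime.\<close>

lemma q_eq_char_power: "prime CHAR('a) \<and> (\<exists>k. q = CHAR('a) ^ k)"
proof -
  obtain p k where pk: "prime p" "k > 0" "q = p ^ k"
    using q_primepow unfolding primepow_def by auto
  have pr: "prime CHAR('a)"
    by (rule prime_CHAR_semidom) (simp add: finite_imp_CHAR_pos)
  have "CHAR('a) dvd p ^ (k * 2)"
    using CHAR_dvd_CARD[where ?'a = 'a] card_field pk(3) by (simp add: power_mult)
  hence "CHAR('a) dvd p"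
    using pr prime_dvd_power by blast
  hence "CHAR('a) = p"
    using pr pk(1) primes_dvd_imp_eq by blast
  thus ?thesis using pr pk by blast
qed

lemma conj_add: "(x + y :: 'a) ^ q = x ^ q + y ^ q"
  using q_eq_char_power freshmans_dream' by blast

lemma conj_sum: "(\<Sum>i\<in>A. f i :: 'a) ^ q = (\<Sum>i\<in>A. f i ^ q)"
  using q_eq_char_power freshmans_dream_sum' by blast

lemma conj_zero: "(0::'a) ^ q = 0"
  using q_gt_1 by simp

lemma conj_minus: "(- x :: 'a) ^ q = - (x ^ q)"
  using conj_add[of x "- x"] conj_zero by (simp add: eq_neg_iff_add_eq_0 add.commute)

lemma conj_diff: "(x - y :: 'a) ^ q = x ^ q - y ^ q"
  using conj_add[of x "- y"] conj_minus[of y] by simp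

lemma conj_conj: "((x::'a) ^ q) ^ q = x"
  using field_power_card[of x] card_field by (simp add: power_mult power2_eq_square)

lemma norm_in_fixed: "(x::'a) ^ (q + 1) \<in> fixed_field"
proof -
  have "(x ^ q * x) ^ q = x * x ^ q"
    by (simp add: power_mult_distrib conj_conj)
  thus ?thesis by (simp add: fixed_field_def mult.commute)
qed

lemma fixed_add: "x \<in> fixed_field \<Longrightarrow> y \<in> fixed_field \<Longrightarrow> x + y \<in> fixed_field"
  by (simp add: fixed_field_def conj_add)

lemma fixed_mult: "x \<in> fixed_field \<Longrightarrow> y \<in> fixed_field \<Longrightarrow> x * y \<in> fixed_field"
  by (simp add: fixed_field_def power_mult_distrib)

lemma fixed_minus: "x \<in> fixed_field \<Longrightarrow> - x \<in> fixed_field"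
  by (simp add: fixed_field_def conj_minus)

lemma fixed_inverse: "x \<in> fixed_field \<Longrightarrow> inverse x \<in> fixed_field"
  by (simp add: fixed_field_def power_inverse)

lemma fixed_zero: "0 \<in> fixed_field"
  by (simp add: fixed_field_def conj_zero)

lemma fixed_sum: "(\<And>i. i \<in> A \<Longrightarrow> f i \<in> fixed_field) \<Longrightarrow> (\<Sum>i\<in>A. f i) \<in> fixed_field"
  by (simp add: fixed_field_def conj_sum)

lemma card_fixed_le: "card fixed_field \<le> q"
proof -
  let ?p = "Polynomial.monom 1 q - Polynomial.monom 1 1 :: 'a poly"
  have "poly.coeff ?p q = 1" using q_gt_1 by simp
  hence "?p \<noteq> 0" by (metis coeff_0 zero_neq_one)
  moreover have "Polynomial.degree ?p \<le> q"
    using q_gt_1 by (intro degree_diff_le) (auto simp: degree_monom_eq)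
  moreover have "fixed_field = {x. poly ?p x = 0}"
    by (auto simp: fixed_field_def poly_monom)
  ultimately show ?thesis using card_roots_le by metis
qed

lemma card_norm_fibre_le: "card {x::'a. x ^ (q + 1) = c} \<le> q + 1"
proof -
  let ?p = "Polynomial.monom 1 (q + 1) - Polynomial.monom c 0 :: 'a poly"
  have "poly.coeff ?p (q + 1) = 1" by simp
  hence "?p \<noteq> 0" by (metis coeff_0 zero_neq_one)
  moreover have "Polynomial.degree ?p \<le> q + 1"
    by (intro degree_diff_le) (auto simp: degree_monom_eq intro: order_trans[OF degree_monom_le])
  moreover have "{x::'a. x ^ (q + 1) = c} = {x. poly ?p x = 0}"
    by (auto simp: poly_monom)
  ultimately show ?thesis using card_roots_le by metis
qed

text \<open>The polynomial \<open>X^q + X\<close> has at most \<open>q\<close> roots, fewer than the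
  \<open>q^2\<close> field elements. The witness later produces a nonzero value of a Hermitian form
  with zero diagonal.\<close>

lemma exists_trace_nonzero: "\<exists>x::'a. x + x ^ q \<noteq> 0"
proof (rule ccontr)
  let ?p = "Polynomial.monom 1 q + Polynomial.monom 1 1 :: 'a poly"
  assume "\<not> ?thesis"
  hence *: "{x. poly ?p x = 0} = UNIV"
    by (auto simp: poly_monom add.commute)
  have "poly.coeff ?p q = 1" using q_gt_1 by simp
  hence "?p \<noteq> 0" by (metis coeff_0 zero_neq_one)
  moreover have "Polynomial.degree ?p \<le> q"
    using q_gt_1 by (intro degree_add_le) (auto simp: degree_monom_eq)
  ultimately have "q ^ 2 \<le> q" using card_roots_le[of ?p q] * card_field by simp
  thus False using q_gt_1 by (simp add: power2_eq_square)
qed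

text \<open>All fibres of the norm over nonzero fixed elements have the maximal size \<open>q + 1\<close>, because
  \<open>q - 1\<close> of them have to cover the \<open>q\<^sup>2 - 1\<close> nonzero elements.\<close>

lemma card_norm_fibre:
  assumes "c \<in> fixed_field" "c \<noteq> 0"
  shows "card {x::'a. x ^ (q + 1) = c} = q + 1"
proof -
  let ?F = "\<lambda>c. {x::'a. x ^ (q + 1) = c}"
  let ?K = "fixed_field - {0}"
  have "UNIV - {0} = (\<Union>c\<in>?K. ?F c)"
    using norm_in_fixed by auto
  hence "q ^ 2 - 1 = card (\<Union>c\<in>?K. ?F c)"
    using card_field by (metis card_Diff_singleton UNIV_I)
  also have "\<dots> = (\<Sum>c\<in>?K. card (?F c))"
    by (rule card_UN_disjoint) auto
  also have "\<dots> = card (?F c) + (\<Sum>c\<in>?K - {c}. card (?F c))"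
    using assms by (intro sum.remove) auto
  also have "(\<Sum>c\<in>?K - {c}. card (?F c)) \<le> card (?K - {c}) * (q + 1)"
    using sum_bounded_above[of "?K - {c}" "\<lambda>c. card (?F c)" "q + 1"] card_norm_fibre_le by simp
  \<comment> \<open>\<open>fixed_field\<close> has at most \<open>q\<close> elements, two of which,
    \<open>0\<close> and \<open>c\<close>, are left out.\<close>
  also have "card (?K - {c}) * (q + 1) \<le> (q - 2) * (q + 1)"
    using card_fixed_le assms fixed_zero
    by (intro mult_le_mono1) (simp add: card_Diff_singleton)
  finally have "q ^ 2 - 1 \<le> card (?F c) + (q - 2) * (q + 1)" by (simp only: add_left_mono)
  \<comment> \<open>Since \<open>q^2 - 1 = (q - 1) (q + 1)\<close>, the other fibres leave at least
    \<open>q + 1\<close> elements for the fibre of \<open>c\<close>.\<close>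
  moreover have "q ^ 2 - 1 = (q + 1) + (q - 2) * (q + 1)"
  proof -
    obtain r where "q = r + 2" using q_gt_1 by (metis add.commute le_Suc_ex Suc_1 Suc_leI One_nat_def)
    thus ?thesis by (simp add: power2_eq_square algebra_simps)
  qed
  ultimately show ?thesis using card_norm_fibre_le[of c] by linarith
qed

text \<open>The sum of all nontrivial characters of the fixed field.\<close>

definition psi :: "'a \<Rightarrow> real" where
  "psi t = (if t = 0 then real q - 1 else - 1)"

lemma psi_conv: "psi t = real q * of_bool (t = 0) - 1"
  by (simp add: psi_def)

lemma sum_psi: "finite A \<Longrightarrow> (\<Sum>x\<in>A. psi (f x)) = real q * real (card {x\<in>A. f x = 0}) - real (card A)"
  by (simp add: psi_conv sum_subtractf Int_def flip: sum_distrib_left)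

text \<open>Counting zeros: \<open>s + a N(y) = 0\<close> prescribes the norm \<open>- s / a\<close>
  of \<open>y\<close>, which has one solution for \<open>s = 0\<close> and \<open>q + 1\<close>
  otherwise. Every norm variable summed out thus gives a factor \<open>- q\<close>, the source of
  the powers \<open>(- q)^n\<close> below.\<close>

lemma sum_psi_norm:
  assumes "s \<in> fixed_field" "a \<in> fixed_field" "a \<noteq> 0"
  shows "(\<Sum>y\<in>UNIV. psi (s + a * y ^ (q + 1))) = - real q * psi s"
proof -
  have "{y. s + a * y ^ (q + 1) = 0} = {y. y ^ (q + 1) = - s * inverse a}"
    using assms(3) by (auto simp: field_simps add_eq_0_iff)
  also have "card \<dots> = (if s = 0 then 1 else q + 1)"
  proof (cases "s = 0")
    case False
    thus ?thesis
      using assms card_norm_fibre[of "- s * inverse a"]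
      by (simp add: fixed_mult fixed_minus fixed_inverse)
  next
    case True
    moreover have "{y::'a. y ^ (q + 1) = 0} = {0}" by auto
    ultimately show ?thesis by simp
  qed
  finally have "card {y. s + a * y ^ (q + 1) = 0} = (if s = 0 then 1 else q + 1)" .
  moreover have "(\<Sum>y\<in>UNIV. psi (s + a * y ^ (q + 1))) =
      real q * real (card {y. s + a * y ^ (q + 1) = 0}) - real (q ^ 2)"
    using sum_psi[of UNIV "\<lambda>y. s + a * y ^ (q + 1)"] card_field by simp
  ultimately show ?thesis
    by (simp only: psi_def) (simp add: power2_eq_square algebra_simps)
qed

end

section \<open>Transitivity of the general linear group\<close>

lemma carrier_vec_Suc: "carrier_vec (Suc n) = (\<lambda>(a, v). vCons a v) ` (UNIV \<times> carrier_vec n)"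
proof (intro equalityI subsetI)
  fix w :: "'a vec" assume "w \<in> carrier_vec (Suc n)"
  thus "w \<in> (\<lambda>(a, v). vCons a v) ` (UNIV \<times> carrier_vec n)"
    by (cases w) force+
qed auto

lemma sum_carrier_vec_Suc:
  fixes f :: "'a::finite vec \<Rightarrow> 'b::comm_monoid_add"
  shows "(\<Sum>w\<in>carrier_vec (Suc n). f w) = (\<Sum>a\<in>UNIV. \<Sum>v\<in>carrier_vec n. f (vCons a v))"
proof -
  have "inj_on (\<lambda>(a, v). vCons a v) (UNIV \<times> carrier_vec n :: ('a \<times> 'a vec) set)"
    by (auto simp: inj_on_def)
  thus ?thesis
    unfolding carrier_vec_Suc sum.cartesian_product by (subst sum.reindex) (auto intro!: sum.cong)
qed

lemma carrier_vec_0: "carrier_vec 0 = {vNil}"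
  by (auto intro!: eq_vecI)

lemma finite_carrier_vec: "finite (carrier_vec n :: 'a::finite vec set)"
  by (induction n) (simp_all add: carrier_vec_0 carrier_vec_Suc)

lemma card_carrier_vec: "card (carrier_vec n :: 'a::finite vec set) = CARD('a) ^ n"
proof (induction n)
  case (Suc n)
  have "inj_on (\<lambda>(a, v). vCons a v) (UNIV \<times> carrier_vec n :: ('a \<times> 'a vec) set)"
    by (auto simp: inj_on_def)
  thus ?case using Suc by (simp only: carrier_vec_Suc card_image card_cartesian_product power_Suc)
qed (simp add: carrier_vec_0)

lemma finite_carrier_mat: "finite (carrier_mat n m :: 'a::finite mat set)"
proof (rule finite_subset)
  let ?L = "{xs. set xs \<subseteq> (carrier_vec m :: 'a vec set) \<and> length xs = n}"
  show "carrier_mat n m \<subseteq> mat_of_rows m ` ?L"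
  proof
    fix A :: "'a mat" assume "A \<in> carrier_mat n m"
    thus "A \<in> mat_of_rows m ` ?L"
      by (intro image_eqI[of _ _ "rows A"]) (auto intro: row_carrier_vec simp: set_conv_nth)
  qed
  show "finite (mat_of_rows m ` ?L)"
    by (intro finite_imageI finite_lists_length_eq finite_carrier_vec)
qed

section \<open>Independent pairs and averages over transitive actions\<close>

definition indep_pairs :: "nat \<Rightarrow> ('a::field vec \<times> 'a vec) set" where
  "indep_pairs n = {(x, y). x \<in> carrier_vec n \<and> y \<in> carrier_vec n \<and> x \<noteq> 0\<^sub>v n \<and> (\<forall>c. y \<noteq> c \<cdot>\<^sub>v x)}"

lemma smult_vec_right_cancel:
  fixes x :: "'a::field vec"
  assumes "x \<in> carrier_vec n" "x \<noteq> 0\<^sub>v n" "c \<cdot>\<^sub>v x = d \<cdot>\<^sub>v x"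
  shows "c = d"
proof -
  obtain i where "i < n" "x $ i \<noteq> 0"
    using assms(1,2) by (metis carrier_vecD eq_vecI index_zero_vec)
  moreover have "(c \<cdot>\<^sub>v x) $ i = (d \<cdot>\<^sub>v x) $ i" using assms(3) by simp
  ultimately show ?thesis using assms(1) by simp
qed

text \<open>All pairs split into the independent ones, those with \<open>x = 0\<close>, and those
  with \<open>x\<close> nonzero and \<open>y\<close> a multiple of \<open>x\<close>. In the last
  class the scalar \<open>c\<close> is unique, so it can serve as summation variable.\<close>

lemma sum_indep_pairs:
  fixes f :: "'a::{field,finite} vec \<Rightarrow> 'a vec \<Rightarrow> 'b::comm_monoid_add"
  shows "(\<Sum>x\<in>carrier_vec n. \<Sum>y\<in>carrier_vec n. f x y) =
    (\<Sum>(x, y)\<in>indep_pairs n. f x y) + (\<Sum>y\<in>carrier_vec n. f (0\<^sub>v n) y) +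
    (\<Sum>x\<in>carrier_vec n - {0\<^sub>v n}. \<Sum>c\<in>UNIV. f x (c \<cdot>\<^sub>v x))"
proof -
  let ?V = "carrier_vec n :: 'a vec set" and ?z = "0\<^sub>v n :: 'a vec"
  let ?m = "\<lambda>(x, c). (x, c \<cdot>\<^sub>v x) :: 'a vec \<times> 'a vec"
  let ?A = "indep_pairs n :: ('a vec \<times> 'a vec) set" and ?B = "{?z} \<times> ?V"
  let ?C = "?m ` ((?V - {?z}) \<times> UNIV)"
  have un: "?V \<times> ?V = (?A \<union> ?B) \<union> ?C"
    by (auto simp: indep_pairs_def)
  have fin: "finite (?V \<times> ?V)" by (simp add: finite_carrier_vec)
  have inj: "inj_on ?m ((?V - {?z}) \<times> UNIV)"
    by (auto simp: inj_on_def intro: smult_vec_right_cancel)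
  have "(\<Sum>x\<in>?V. \<Sum>y\<in>?V. f x y) = (\<Sum>(x, y)\<in>?V \<times> ?V. f x y)"
    by (simp add: sum.cartesian_product)
  also have "\<dots> = (\<Sum>(x, y)\<in>?A \<union> ?B. f x y) + (\<Sum>(x, y)\<in>?C. f x y)"
    unfolding un by (rule sum.union_disjoint) (use fin[unfolded un] in \<open>auto simp: indep_pairs_def\<close>)
  also have "(\<Sum>(x, y)\<in>?A \<union> ?B. f x y) = (\<Sum>(x, y)\<in>?A. f x y) + (\<Sum>(x, y)\<in>?B. f x y)"
    by (rule sum.union_disjoint) (use fin[unfolded un] in \<open>auto simp: indep_pairs_def\<close>)
  also have "(\<Sum>(x, y)\<in>?B. f x y) = (\<Sum>y\<in>?V. f ?z y)"
    by (simp flip: sum.cartesian_product)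
  also have "(\<Sum>(x, y)\<in>?C. f x y) = (\<Sum>(x, c)\<in>(?V - {?z}) \<times> UNIV. f x (c \<cdot>\<^sub>v x))"
    by (subst sum.reindex[OF inj]) (simp add: case_prod_beta)
  also have "\<dots> = (\<Sum>x\<in>?V - {?z}. \<Sum>c\<in>UNIV. f x (c \<cdot>\<^sub>v x))"
    by (simp add: sum.cartesian_product)
  finally show ?thesis by simp
qed

lemma finite_indep_pairs: "finite (indep_pairs n :: ('a::{field,finite} vec \<times> 'a vec) set)"
  by (rule finite_subset[of _ "carrier_vec n \<times> carrier_vec n"])
    (auto simp: indep_pairs_def finite_carrier_vec)

text \<open>Reindexing by \<open>b\<close> shows that the sum over \<open>G\<close> is the same for
  every point of \<open>T\<close>. Summed over all points with the sums exchanged, each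
  \<open>act g\<close> merely permutes \<open>T\<close>. For matrices, \<open>b\<close> is right
  multiplication by an element taking \<open>s\<close> to \<open>t\<close>.\<close>

lemma sum_average_transitive:
  fixes f :: "'t \<Rightarrow> real"
  assumes "finite G"
    and perm: "\<And>g. g \<in> G \<Longrightarrow> bij_betw (act g) T T"
    and trans: "\<And>s t. s \<in> T \<Longrightarrow> t \<in> T \<Longrightarrow> \<exists>b. bij_betw b G G \<and> (\<forall>g\<in>G. act (b g) s = act g t)"
    and "t \<in> T"
  shows "real (card T) * (\<Sum>g\<in>G. f (act g t)) = real (card G) * (\<Sum>s\<in>T. f s)"
proof -
  have "(\<Sum>g\<in>G. f (act g s)) = (\<Sum>g\<in>G. f (act g t))" if s: "s \<in> T" for s
  proof -
    obtain b where b: "bij_betw b G G" "\<forall>g\<in>G. act (b g) s = act g t"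
      using trans[OF s \<open>t \<in> T\<close>] by blast
    have "(\<Sum>g\<in>G. f (act g s)) = (\<Sum>g\<in>G. f (act (b g) s))"
      by (rule sum.reindex_bij_betw[OF b(1), symmetric])
    also have "\<dots> = (\<Sum>g\<in>G. f (act g t))"
      using b(2) by (intro sum.cong) auto
    finally show ?thesis .
  qed
  hence "real (card T) * (\<Sum>g\<in>G. f (act g t)) = (\<Sum>s\<in>T. \<Sum>g\<in>G. f (act g s))" by simp
  also have "\<dots> = (\<Sum>g\<in>G. \<Sum>s\<in>T. f (act g s))" by (rule sum.swap)
  also have "\<dots> = (\<Sum>g\<in>G. \<Sum>s\<in>T. f s)"
    by (intro sum.cong refl sum.reindex_bij_betw perm)
  finally show ?thesis by simp
qed

section \<open>The group of invertible matrices\<close>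

definition GL :: "nat \<Rightarrow> 'a::field mat set" where
  "GL n = {g \<in> carrier_mat n n. \<exists>h\<in>carrier_mat n n. g * h = 1\<^sub>m n \<and> h * g = 1\<^sub>m n}"

lemma GL_carrier: "g \<in> GL n \<Longrightarrow> g \<in> carrier_mat n n"
  by (simp add: GL_def)

lemma GL_mult:
  assumes "g \<in> GL n" "h \<in> GL n"
  shows "g * h \<in> GL n"
proof -
  obtain g' h' where inv: "g' \<in> carrier_mat n n" "g * g' = 1\<^sub>m n" "g' * g = 1\<^sub>m n"
    "h' \<in> carrier_mat n n" "h * h' = 1\<^sub>m n" "h' * h = 1\<^sub>m n"
    using assms unfolding GL_def by blast
  have c: "g \<in> carrier_mat n n" "h \<in> carrier_mat n n" using assms by (auto simp: GL_def)
  have "(g * h) * (h' * g') = g * (h * h') * g'"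
    using c inv by (smt (verit) assoc_mult_mat mult_carrier_mat)
  moreover have "(h' * g') * (g * h) = h' * (g' * g) * h"
    using c inv by (smt (verit) assoc_mult_mat mult_carrier_mat)
  ultimately have "(g * h) * (h' * g') = 1\<^sub>m n" "(h' * g') * (g * h) = 1\<^sub>m n"
    using c inv by simp_all
  thus ?thesis
    unfolding GL_def using c inv mult_carrier_mat by blast
qed

lemma one_GL: "1\<^sub>m n \<in> GL n"
  by (auto simp: GL_def intro!: bexI[of _ "1\<^sub>m n"])

lemma GL_inj:
  assumes "g \<in> GL n" "x \<in> carrier_vec n" "y \<in> carrier_vec n" "g *\<^sub>v x = g *\<^sub>v y"
  shows "x = y"
proof -
  obtain h where h: "h \<in> carrier_mat n n" "h * g = 1\<^sub>m n" and g: "g \<in> carrier_mat n n"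
    using assms(1) unfolding GL_def by blast
  have "h *\<^sub>v (g *\<^sub>v z) = z" if "z \<in> carrier_vec n" for z
    using that g h by (metis assoc_mult_mat_vec one_mult_mat_vec)
  thus ?thesis using assms(2-4) by metis
qed

lemma GL_bij_right_mult:
  assumes "h \<in> GL n"
  shows "bij_betw (\<lambda>g. g * h) (GL n) (GL n :: 'a::{field,finite} mat set)"
proof (rule bij_betw_imageI)
  obtain h' where h': "h' \<in> carrier_mat n n" "h * h' = 1\<^sub>m n" and h: "h \<in> carrier_mat n n"
    using assms unfolding GL_def by blast
  have canc: "g * h * h' = g" if "g \<in> carrier_mat n n" for g
    using that h h' by (metis assoc_mult_mat right_mult_one_mat)
  show inj: "inj_on (\<lambda>g. g * h) (GL n)"
    by (rule inj_onI) (metis canc GL_carrier)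
  have "finite (GL n :: 'a mat set)"
    by (rule finite_subset[OF _ finite_carrier_mat[of n n]]) (auto simp: GL_def)
  thus "(\<lambda>g. g * h) ` GL n = GL n"
    using inj by (intro endo_inj_surj) (auto intro: GL_mult assms)
qed

lemma finite_GL: "finite (GL n :: 'a::{field,finite} mat set)"
  by (rule finite_subset[OF _ finite_carrier_mat[of n n]]) (auto simp: GL_def)

section \<open>Functionals, transvections and transitivity\<close>

lemma exists_functional:
  fixes x y :: "'a::field vec"
  assumes [simp]: "x \<in> carrier_vec n" "y \<in> carrier_vec n" and ind: "\<forall>c. y \<noteq> c \<cdot>\<^sub>v x"
  shows "\<exists>f\<in>carrier_vec n. f \<bullet> x = 0 \<and> f \<bullet> y \<noteq> 0"
proof (cases "x = 0\<^sub>v n")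
  case True
  have "y \<noteq> 0\<^sub>v n" using ind[rule_format, of 0] True by auto
  then obtain i where "i < n" "y $ i \<noteq> 0"
    using assms(2) by (metis carrier_vecD eq_vecI index_zero_vec)
  thus ?thesis using True by (intro bexI[of _ "unit_vec n i"]) auto
next
  case False
  then obtain i where i: "i < n" "x $ i \<noteq> 0"
    using assms(1) by (metis carrier_vecD eq_vecI index_zero_vec)
  have "\<exists>j<n. y $ j \<noteq> y $ i / x $ i * x $ j"
  proof (rule ccontr)
    assume "\<not> ?thesis"
    hence "y = (y $ i / x $ i) \<cdot>\<^sub>v x"
      using carrier_vecD[OF assms(1)] carrier_vecD[OF assms(2)]
      by (intro eq_vecI) (auto simp del: assms)
    thus False using ind by blast
  qed
  then obtain j where j: "j < n" "x $ i * y $ j \<noteq> x $ j * y $ i"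
    using i by (auto simp: field_simps)
  \<comment> \<open>A 2 by 2 minor against \<open>x\<close>: it kills \<open>x\<close>, and on
    \<open>y\<close> it is nonzero by the choice of \<open>j\<close>, which exists as
    \<open>y\<close> is not a multiple of \<open>x\<close>.\<close>
  let ?f = "x $ i \<cdot>\<^sub>v unit_vec n j - x $ j \<cdot>\<^sub>v unit_vec n i"
  have "?f \<bullet> z = x $ i * z $ j - x $ j * z $ i" if "z \<in> carrier_vec n" for z
    using that i(1) j(1) by (simp add: minus_scalar_prod_distrib[of _ n])
  thus ?thesis using j by (intro bexI[of _ ?f]) (auto simp: mult.commute)
qed

text \<open>If neither the functional \<open>f\<close> for \<open>y\<close> nor the functional
  \<open>g\<close> for \<open>z\<close> serves both vectors, then \<open>f\<close> vanishes on
  \<open>z\<close> and \<open>g\<close> on \<open>y\<close>, and \<open>f + g\<close> serves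
  both.\<close>

lemma exists_common_functional:
  fixes x y z :: "'a::field vec"
  assumes [simp]: "x \<in> carrier_vec n" "y \<in> carrier_vec n" "z \<in> carrier_vec n"
    and "\<forall>c. y \<noteq> c \<cdot>\<^sub>v x" "\<forall>c. z \<noteq> c \<cdot>\<^sub>v x"
  shows "\<exists>f\<in>carrier_vec n. f \<bullet> x = 0 \<and> f \<bullet> y \<noteq> 0 \<and> f \<bullet> z \<noteq> 0"
proof -
  obtain f where f: "f \<in> carrier_vec n" "f \<bullet> x = 0" "f \<bullet> y \<noteq> 0"
    using exists_functional[OF assms(1,2,4)] by blast
  obtain g where g: "g \<in> carrier_vec n" "g \<bullet> x = 0" "g \<bullet> z \<noteq> 0"
    using exists_functional[OF assms(1,3,5)] by blast
  consider "f \<bullet> z \<noteq> 0" | "g \<bullet> y \<noteq> 0" | "f \<bullet> z = 0" "g \<bullet> y = 0" by blast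
  thus ?thesis
  proof cases
    case 3
    thus ?thesis using f g
      by (intro bexI[of _ "f + g"]) (auto simp: add_scalar_prod_distrib[of _ n])
  qed (use f g in auto)
qed

text \<open>The transvection \<open>1 + (z - y) f\<^sup>T\<close> with \<open>f x = 0\<close>, \<open>f y = 1\<close>, \<open>f z \<noteq> 0\<close>.\<close>

lemma GL_transitive_fixing:
  fixes x y z :: "'a::field vec"
  assumes x: "x \<in> carrier_vec n" and y: "y \<in> carrier_vec n" and z: "z \<in> carrier_vec n"
    and "\<forall>c. y \<noteq> c \<cdot>\<^sub>v x" "\<forall>c. z \<noteq> c \<cdot>\<^sub>v x"
  shows "\<exists>h\<in>GL n. h *\<^sub>v x = x \<and> h *\<^sub>v y = z"
proof -
  obtain f0 where f0: "f0 \<in> carrier_vec n" "f0 \<bullet> x = 0" "f0 \<bullet> y \<noteq> 0" "f0 \<bullet> z \<noteq> 0"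
    using exists_common_functional[OF assms] by blast
  define f where "f = inverse (f0 \<bullet> y) \<cdot>\<^sub>v f0"
  have f: "f \<in> carrier_vec n" "f \<bullet> x = 0" "f \<bullet> y = 1" "f \<bullet> z \<noteq> 0"
  proof -
    have "f \<bullet> v = inverse (f0 \<bullet> y) * (f0 \<bullet> v)" if "v \<in> carrier_vec n" for v
      unfolding f_def using f0(1) that by (rule smult_scalar_prod_distrib)
    thus "f \<bullet> x = 0" "f \<bullet> y = 1" "f \<bullet> z \<noteq> 0"
      using f0(2-4) x y z by simp_all
    show "f \<in> carrier_vec n" using f0(1) by (simp add: f_def)
  qed
  define u where "u = z - y"
  have u: "u \<in> carrier_vec n" using y z by (simp add: u_def)
  have fu: "f \<bullet> u = f \<bullet> z - 1"
    using f y z by (simp add: u_def scalar_prod_minus_distrib[of _ n])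
  \<comment> \<open>The one-parameter family \<open>1 + c u f^T\<close> contains the transvection,
    at \<open>c = 1\<close>, together with its inverse.\<close>
  define T where "T = (\<lambda>c. mat n n (\<lambda>(i, j). (if i = j then 1 else 0) + c * u $ i * f $ j))"
  have T: "T c \<in> carrier_mat n n" for c by (simp add: T_def)
  have Tv: "T c *\<^sub>v v = v + (c * (f \<bullet> v)) \<cdot>\<^sub>v u" if v: "v \<in> carrier_vec n" for c v
  proof (rule eq_vecI)
    fix i assume "i < dim_vec (v + (c * (f \<bullet> v)) \<cdot>\<^sub>v u)"
    hence i: "i < n" using u by simp
    have "(T c *\<^sub>v v) $ i = (\<Sum>j<n. ((if i = j then 1 else 0) + c * u $ i * f $ j) * v $ j)"
      using i v by (simp add: T_def scalar_prod_def atLeast0LessThan)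
    also have "\<dots> = (\<Sum>j<n. (if i = j then v $ j else 0) + c * u $ i * (f $ j * v $ j))"
      by (intro sum.cong) (auto simp: algebra_simps)
    also have "\<dots> = v $ i + c * u $ i * (f \<bullet> v)"
      using i v by (simp add: scalar_prod_def atLeast0LessThan sum.distrib flip: sum_distrib_left)
    finally show "(T c *\<^sub>v v) $ i = (v + (c * (f \<bullet> v)) \<cdot>\<^sub>v u) $ i"
      using i u v by simp
  qed (use u v T in auto)
  \<comment> \<open>Composition stays in the family, since \<open>f u = f z - 1\<close>: the
    parameters \<open>c\<close> and \<open>d\<close> combine to
    \<open>c + d + c d (f z - 1)\<close>.\<close>
  have TT: "T c *\<^sub>v (T d *\<^sub>v v) = v + ((c + d + c * d * (f \<bullet> z - 1)) * (f \<bullet> v)) \<cdot>\<^sub>v u"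
    if v: "v \<in> carrier_vec n" for c d v
  proof -
    let ?k = "d * (f \<bullet> v)"
    have "f \<bullet> (v + ?k \<cdot>\<^sub>v u) = f \<bullet> v + ?k * (f \<bullet> z - 1)"
      using v u f(1) fu by (simp add: scalar_prod_add_distrib[of _ n])
    hence "T c *\<^sub>v (T d *\<^sub>v v) = v + ?k \<cdot>\<^sub>v u + (c * (f \<bullet> v + ?k * (f \<bullet> z - 1))) \<cdot>\<^sub>v u"
      using u v by (simp add: Tv)
    thus ?thesis using u v by (intro eq_vecI) (auto simp: algebra_simps)
  qed
  have zu: "0 \<cdot>\<^sub>v u = 0\<^sub>v n" using u by auto
  \<comment> \<open>The solution of \<open>1 + d + d (f z - 1) = 0\<close>, so that
    \<open>T d\<close> inverts \<open>T 1\<close>; it exists because \<open>f z\<close> is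
    nonzero.\<close>
  define d where "d = - inverse (f \<bullet> z)"
  have one: "T c * T d = 1\<^sub>m n" if "c + d + c * d * (f \<bullet> z - 1) = 0" for c d
  proof (rule eq_matI)
    fix i j assume ij: "i < dim_row (1\<^sub>m n :: 'a mat)" "j < dim_col (1\<^sub>m n :: 'a mat)"
    have "(T c * T d) *\<^sub>v unit_vec n j = unit_vec n j"
      using TT[of "unit_vec n j" c d] that T[of c] T[of d] u zu
      by (simp add: assoc_mult_mat_vec[of _ n n _ n])
    moreover have "((T c * T d) *\<^sub>v unit_vec n j) $ i = (T c * T d) $$ (i, j)"
      using carrier_matD[OF T[of c]] carrier_matD[OF T[of d]] ij by simp
    ultimately show "(T c * T d) $$ (i, j) = 1\<^sub>m n $$ (i, j)"
      using ij by simp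
  qed (use T in auto)
  have "T 1 \<in> GL n"
  proof -
    have "1 + d + 1 * d * (f \<bullet> z - 1) = 0" "d + 1 + d * 1 * (f \<bullet> z - 1) = 0"
      using f(4) by (simp_all add: d_def field_simps)
    from one[OF this(1)] one[OF this(2)] show ?thesis unfolding GL_def using T by blast
  qed
  moreover have "T 1 *\<^sub>v x = x" using f x u by (simp add: Tv zu)
  moreover have "T 1 *\<^sub>v y = z" using f y z u
    by (intro eq_vecI) (simp_all add: Tv, simp_all add: u_def)
  ultimately show ?thesis by blast
qed

lemma GL_mult_vec_smult:
  assumes "g \<in> GL n" "x \<in> carrier_vec n"
  shows "g *\<^sub>v (c \<cdot>\<^sub>v x) = c \<cdot>\<^sub>v (g *\<^sub>v x)"
  using mult_mat_vec[OF GL_carrier[OF assms(1)] assms(2)] .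

text \<open>The case of a zero fixed vector: being no multiple of \<open>0\<close> means being
  nonzero.\<close>

lemma GL_transitive_nonzero:
  fixes x y :: "'a::field vec"
  assumes "x \<in> carrier_vec n - {0\<^sub>v n}" "y \<in> carrier_vec n - {0\<^sub>v n}"
  shows "\<exists>h\<in>GL n. h *\<^sub>v x = y"
proof -
  have "c \<cdot>\<^sub>v 0\<^sub>v n = (0\<^sub>v n :: 'a vec)" for c by auto
  thus ?thesis using GL_transitive_fixing[of "0\<^sub>v n" n x y] assms by auto
qed

lemma GL_mult_vec_nonzero:
  assumes "g \<in> GL n" "x \<in> carrier_vec n - {0\<^sub>v n}"
  shows "g *\<^sub>v x \<in> carrier_vec n - {0\<^sub>v n}"
proof -
  have g: "g \<in> carrier_mat n n" using assms(1) by (rule GL_carrier)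
  have "g *\<^sub>v 0\<^sub>v n = 0\<^sub>v n" using g by auto
  thus ?thesis using GL_inj[OF assms(1), of x "0\<^sub>v n"] assms(2) g by auto
qed

lemma GL_indep_pairs:
  assumes "g \<in> GL n" "(x, y) \<in> indep_pairs n"
  shows "(g *\<^sub>v x, g *\<^sub>v y) \<in> indep_pairs n"
proof -
  have g: "g \<in> carrier_mat n n" using assms(1) by (rule GL_carrier)
  have xy: "x \<in> carrier_vec n - {0\<^sub>v n}" "y \<in> carrier_vec n" "\<forall>c. y \<noteq> c \<cdot>\<^sub>v x"
    using assms(2) by (auto simp: indep_pairs_def)
  have "g *\<^sub>v y \<noteq> c \<cdot>\<^sub>v (g *\<^sub>v x)" for c
    using GL_inj[OF assms(1), of y "c \<cdot>\<^sub>v x"] GL_mult_vec_smult[OF assms(1), of x c] xy by auto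
  thus ?thesis
    using GL_mult_vec_nonzero[OF assms(1) xy(1)] g xy by (auto simp: indep_pairs_def)
qed

text \<open>First \<open>x\<close> is moved to \<open>x'\<close>; then an element fixing
  \<open>x'\<close> moves the image of \<open>y\<close>, still independent of \<open>x'\<close>, to
  \<open>y'\<close>.\<close>

lemma GL_transitive_indep_pairs:
  fixes x y x' y' :: "'a::field vec"
  assumes "(x, y) \<in> indep_pairs n" "(x', y') \<in> indep_pairs n"
  shows "\<exists>h\<in>GL n. h *\<^sub>v x = x' \<and> h *\<^sub>v y = y'"
proof -
  obtain g where g: "g \<in> GL n" "g *\<^sub>v x = x'"
    using GL_transitive_nonzero[of x n x'] assms by (auto simp: indep_pairs_def)
  have "(x', g *\<^sub>v y) \<in> indep_pairs n" using GL_indep_pairs[OF g(1) assms(1)] g(2) by simp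
  then obtain h where h: "h \<in> GL n" "h *\<^sub>v x' = x'" "h *\<^sub>v (g *\<^sub>v y) = y'"
    using GL_transitive_fixing[of x' n "g *\<^sub>v y" y'] assms(2) by (auto simp: indep_pairs_def)
  have "h * g \<in> GL n" using GL_mult h g by blast
  moreover have "(h * g) *\<^sub>v v = h *\<^sub>v (g *\<^sub>v v)" if "v \<in> carrier_vec n" for v
    using that GL_carrier[OF h(1)] GL_carrier[OF g(1)] by (metis assoc_mult_mat_vec)
  ultimately show ?thesis
    using h g assms by (intro bexI[of _ "h * g"]) (auto simp: indep_pairs_def)
qed

section \<open>Orbit sums over the invertible matrices\<close>

lemma sum_GL_nonzero:
  fixes f :: "'a::{field,finite} vec \<Rightarrow> real"
  assumes "x \<in> carrier_vec n - {0\<^sub>v n}"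
  shows "real (card (carrier_vec n - {0\<^sub>v n} :: 'a vec set)) * (\<Sum>g\<in>GL n. f (g *\<^sub>v x)) =
    real (card (GL n :: 'a mat set)) * (\<Sum>y\<in>carrier_vec n - {0\<^sub>v n}. f y)"
proof (rule sum_average_transitive)
  fix g :: "'a mat" assume g: "g \<in> GL n"
  let ?T = "carrier_vec n - {0\<^sub>v n} :: 'a vec set"
  have "inj_on ((*\<^sub>v) g) ?T"
    using GL_inj[OF g] by (auto simp: inj_on_def)
  thus "bij_betw ((*\<^sub>v) g) ?T ?T"
    using GL_mult_vec_nonzero[OF g]
    by (intro bij_betw_imageI endo_inj_surj) (auto simp: finite_carrier_vec)
next
  fix s t :: "'a vec"
  assume st: "s \<in> carrier_vec n - {0\<^sub>v n}" "t \<in> carrier_vec n - {0\<^sub>v n}"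
  then obtain h where h: "h \<in> GL n" "h *\<^sub>v s = t" using GL_transitive_nonzero by blast
  show "\<exists>b. bij_betw b (GL n) (GL n) \<and> (\<forall>g\<in>GL n. b g *\<^sub>v s = g *\<^sub>v t)"
    using GL_bij_right_mult[OF h(1)] h st
    by (intro exI[of _ "\<lambda>g. g * h"]) (auto simp: assoc_mult_mat_vec[OF GL_carrier GL_carrier])
qed (use assms finite_GL in auto)

lemma sum_GL_indep_pairs:
  fixes f :: "'a::{field,finite} vec \<Rightarrow> 'a vec \<Rightarrow> real"
  assumes "(x, y) \<in> indep_pairs n"
  shows "real (card (indep_pairs n :: ('a vec \<times> 'a vec) set)) * (\<Sum>g\<in>GL n. f (g *\<^sub>v x) (g *\<^sub>v y)) =
    real (card (GL n :: 'a mat set)) * (\<Sum>(x, y)\<in>indep_pairs n. f x y)"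
proof -
  let ?T = "indep_pairs n :: ('a vec \<times> 'a vec) set"
  let ?act = "\<lambda>g (x, y). (g *\<^sub>v x, g *\<^sub>v y) :: 'a vec \<times> 'a vec"
  have "real (card ?T) * (\<Sum>g\<in>GL n. case_prod f (?act g (x, y))) =
    real (card (GL n :: 'a mat set)) * (\<Sum>t\<in>?T. case_prod f t)"
  proof (rule sum_average_transitive)
    fix g :: "'a mat" assume g: "g \<in> GL n"
    have "inj_on (?act g) ?T"
      using GL_inj[OF g] by (auto simp: inj_on_def indep_pairs_def)
    thus "bij_betw (?act g) ?T ?T"
      using GL_indep_pairs[OF g]
      by (intro bij_betw_imageI endo_inj_surj) (auto simp: finite_indep_pairs)
  next
    fix s t assume st: "s \<in> ?T" "t \<in> ?T"
    then obtain h where h: "h \<in> GL n" "h *\<^sub>v fst s = fst t" "h *\<^sub>v snd s = snd t"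
      using GL_transitive_indep_pairs[of "fst s" "snd s" n "fst t" "snd t"] by auto
    show "\<exists>b. bij_betw b (GL n) (GL n) \<and> (\<forall>g\<in>GL n. ?act (b g) s = ?act g t)"
      using GL_bij_right_mult[OF h(1)] h st
      by (intro exI[of _ "\<lambda>g. g * h"])
         (auto simp: assoc_mult_mat_vec[OF GL_carrier GL_carrier] indep_pairs_def case_prod_beta)
  qed (use assms finite_GL in auto)
  thus ?thesis by simp
qed

section \<open>Averages over the general linear group\<close>

context conj_field
begin

definition herm :: "'a vec \<Rightarrow> 'a" where
  "herm w = (\<Sum>i<dim_vec w. (w $ i) ^ (q + 1))"

lemma herm_vCons: "herm (vCons a v) = a ^ (q + 1) + herm v"
  unfolding herm_def dim_vec_vCons sum.lessThan_Suc_shift by simp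

lemma herm_smult: "herm (c \<cdot>\<^sub>v w) = c ^ (q + 1) * herm w"
  by (simp add: herm_def sum_distrib_left power_mult_distrib mult_ac)

lemma herm_zero: "herm (0\<^sub>v n) = 0"
  by (simp add: herm_def)

lemma herm_fixed: "herm w \<in> fixed_field"
  unfolding herm_def by (intro fixed_sum norm_in_fixed)

text \<open>Each coordinate contributes a factor \<open>- q\<close> by \<open>sum_psi_norm\<close>.
  The shift \<open>s\<close> is kept arbitrary so that the induction on \<open>n\<close> can absorb
  the first coordinate into it.\<close>

lemma sum_psi_herm:
  assumes "s \<in> fixed_field" "a \<in> fixed_field" "a \<noteq> 0"
  shows "(\<Sum>w\<in>carrier_vec n. psi (s + a * herm w)) = (- real q) ^ n * psi s"
  using assms(1)
proof (induction n arbitrary: s)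
  case 0
  thus ?case by (simp add: carrier_vec_0 herm_def)
next
  case (Suc n)
  have "(\<Sum>w\<in>carrier_vec (Suc n). psi (s + a * herm w)) =
      (\<Sum>y\<in>UNIV. \<Sum>v\<in>carrier_vec n. psi ((s + a * y ^ (q + 1)) + a * herm v))"
    by (simp only: sum_carrier_vec_Suc herm_vCons distrib_left add.assoc)
  also have "\<dots> = (\<Sum>y\<in>UNIV. (- real q) ^ n * psi (s + a * y ^ (q + 1)))"
    using Suc.prems assms(2) by (intro sum.cong refl Suc.IH fixed_add fixed_mult norm_in_fixed)
  also have "\<dots> = (- real q) ^ n * (- real q * psi s)"
    by (simp only: sum_distrib_left[symmetric] sum_psi_norm[OF Suc.prems assms(2,3)])
  finally show ?case by simp
qed

text \<open>The count \<open>q^(2n)\<close> is written through \<open>(- q)^n\<close> because the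
  sums below become polynomials in that quantity, whatever the parity of \<open>n\<close>.\<close>

lemma card_carrier_vec_field: "real (card (carrier_vec n :: 'a vec set)) = ((- real q) ^ n)\<^sup>2"
proof -
  have "real (card (carrier_vec n :: 'a vec set)) = ((- real q) ^ 2) ^ n"
    by (simp add: card_carrier_vec card_field)
  thus ?thesis by (metis mult.commute power_mult)
qed

lemma card_nonzero_vec:
  "real (card (carrier_vec n - {0\<^sub>v n} :: 'a vec set)) = ((- real q) ^ n)\<^sup>2 - 1"
proof -
  have "card (carrier_vec n :: 'a vec set) > 0"
    using finite_carrier_vec card_gt_0_iff by (metis empty_iff zero_carrier_vec)
  thus ?thesis
    using card_carrier_vec_field[of n]
    by (simp add: card_Diff_singleton of_nat_diff)
qed

text \<open>For \<open>t = 0\<close> every vector contributes \<open>q - 1\<close>, otherwise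
  \<open>sum_psi_herm\<close> applies; the zero vector is then removed. A single formula with an
  indicator allows summation over varying \<open>t\<close> afterwards.\<close>

lemma sum_psi_herm_nonzero:
  assumes "t \<in> fixed_field"
  shows "(\<Sum>w\<in>carrier_vec n - {0\<^sub>v n}. psi (t * herm w)) =
    (real q - 1) * ((- real q) ^ n - 1 + (((- real q) ^ n)\<^sup>2 - (- real q) ^ n) * of_bool (t = 0))"
proof -
  have "(\<Sum>w\<in>carrier_vec n. psi (t * herm w)) =
      (real q - 1) * ((- real q) ^ n + (((- real q) ^ n)\<^sup>2 - (- real q) ^ n) * of_bool (t = 0))"
  proof (cases "t = 0")
    case True
    thus ?thesis by (simp add: psi_def card_carrier_vec_field)
  next
    case False
    thus ?thesis using sum_psi_herm[OF fixed_zero assms False, of n] by (simp add: psi_def)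
  qed
  moreover have "(\<Sum>w\<in>carrier_vec n - {0\<^sub>v n}. psi (t * herm w)) =
      (\<Sum>w\<in>carrier_vec n. psi (t * herm w)) - (real q - 1)"
    by (subst sum_diff) (auto simp: finite_carrier_vec herm_zero psi_def)
  ultimately show ?thesis by (simp add: algebra_simps)
qed

text \<open>The sum over all pairs is evaluated one vector at a time. From it are subtracted the
  pairs with \<open>x = 0\<close> and the pairs \<open>(x, c x)\<close>, on which the form collapses
  to \<open>(a + b N(c)) herm x\<close> with \<open>N(c) = c^(q+1)\<close>.\<close>

lemma sum_psi_indep_pairs:
  fixes n :: nat
  assumes a: "a \<in> fixed_field" "a \<noteq> 0" and b: "b \<in> fixed_field" "b \<noteq> 0"
  defines "s \<equiv> (- real q) ^ n"
  shows "(\<Sum>(x, y)\<in>indep_pairs n. psi (a * herm x + b * herm y)) =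
    - (real q - 1) * real q * (s - 1) * (s + real q)"
proof -
  let ?V = "carrier_vec n :: 'a vec set" and ?r = "real q - 1"
  have "(\<Sum>x\<in>?V. \<Sum>y\<in>?V. psi (a * herm x + b * herm y)) = (\<Sum>x\<in>?V. s * psi (a * herm x))"
    unfolding s_def by (intro sum.cong refl sum_psi_herm fixed_mult herm_fixed a b)
  also have "\<dots> = s * (s * ?r)"
    using sum_psi_herm[OF fixed_zero a, of n] by (simp add: psi_def s_def flip: sum_distrib_left)
  finally have all: "(\<Sum>x\<in>?V. \<Sum>y\<in>?V. psi (a * herm x + b * herm y)) = s\<^sup>2 * ?r"
    by (simp add: power2_eq_square)
  have zero: "(\<Sum>y\<in>?V. psi (a * herm (0\<^sub>v n) + b * herm y)) = s * ?r"
    using sum_psi_herm[OF fixed_zero b, of n] by (simp add: herm_zero psi_def s_def)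
  \<comment> \<open>The number of \<open>c\<close> for which the collapsed form vanishes
    identically, read off from \<open>sum_psi_norm\<close> by solving \<open>psi_conv\<close> for
    the indicator.\<close>
  have "(\<Sum>c\<in>UNIV. of_bool (a + b * c ^ (q + 1) = 0) :: real) =
      (\<Sum>c\<in>UNIV. (psi (a + b * c ^ (q + 1)) + 1) / real q)"
    using q_gt_1 by (simp add: psi_conv del: power_Suc)
  also have "\<dots> = ((\<Sum>c\<in>UNIV. psi (a + b * c ^ (q + 1))) + real q ^ 2) / real q"
    by (simp add: sum.distrib card_field flip: sum_divide_distrib del: power_Suc)
  also have "\<dots> = real q + 1"
    unfolding sum_psi_norm[OF a(1) b] using q_gt_1 a(2) by (simp add: psi_def power2_eq_square field_simps)
  finally have zeros: "(\<Sum>c\<in>UNIV. of_bool (a + b * c ^ (q + 1) = 0) :: real) = real q + 1" .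
  have "(\<Sum>x\<in>?V - {0\<^sub>v n}. \<Sum>c\<in>UNIV. psi (a * herm x + b * herm (c \<cdot>\<^sub>v x))) =
      (\<Sum>x\<in>?V - {0\<^sub>v n}. \<Sum>c\<in>UNIV. psi ((a + b * c ^ (q + 1)) * herm x))"
    by (simp only: herm_smult distrib_right mult.assoc)
  also have "\<dots> = (\<Sum>c\<in>UNIV. \<Sum>x\<in>?V - {0\<^sub>v n}. psi ((a + b * c ^ (q + 1)) * herm x))"
    by (rule sum.swap)
  also have "\<dots> = (\<Sum>c\<in>UNIV. ?r * (s - 1 + (s\<^sup>2 - s) * of_bool (a + b * c ^ (q + 1) = 0)))"
    unfolding s_def
    by (intro sum.cong refl sum_psi_herm_nonzero fixed_add fixed_mult norm_in_fixed a b)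
  also have "\<dots> = ?r * (real q ^ 2 * (s - 1) + (s\<^sup>2 - s) * (real q + 1))"
    by (simp only: sum_distrib_left[symmetric] sum.distrib zeros) (simp add: card_field)
  finally have dep: "(\<Sum>x\<in>?V - {0\<^sub>v n}. \<Sum>c\<in>UNIV. psi (a * herm x + b * herm (c \<cdot>\<^sub>v x))) =
      ?r * (real q ^ 2 * (s - 1) + (s\<^sup>2 - s) * (real q + 1))" .
  show ?thesis
    using sum_indep_pairs[of "\<lambda>x y. psi (a * herm x + b * herm y)" n] all zero dep
    by (simp add: algebra_simps power2_eq_square)
qed

text \<open>The same splitting of pairs, applied to the constant function \<open>1\<close>.\<close>

lemma card_indep_pairs:
  fixes n :: nat
  defines "s \<equiv> (- real q) ^ n"
  shows "real (card (indep_pairs n :: ('a vec \<times> 'a vec) set)) = (s\<^sup>2 - 1) * (s\<^sup>2 - real q ^ 2)"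
proof -
  have "(\<Sum>x\<in>(carrier_vec n :: 'a vec set). \<Sum>y\<in>(carrier_vec n :: 'a vec set). 1) =
      (\<Sum>(x, y)\<in>(indep_pairs n :: ('a vec \<times> 'a vec) set). 1) + (\<Sum>y\<in>(carrier_vec n :: 'a vec set). 1) +
      (\<Sum>x\<in>(carrier_vec n :: 'a vec set) - {0\<^sub>v n}. \<Sum>c\<in>(UNIV :: 'a set). (1::real))"
    using sum_indep_pairs[of "\<lambda>(x :: 'a vec) (y :: 'a vec). 1 :: real" n] .
  thus ?thesis
    unfolding case_prod_beta sum_constant card_carrier_vec_field card_nonzero_vec card_field
    by (simp add: s_def algebra_simps power2_eq_square)
qed

section \<open>Averages of \<open>psi\<close> for diagonal forms of rank one and two\<close>

lemma minus_q_power_not: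
  assumes "n \<ge> 2"
  shows "(- real q) ^ n \<noteq> 1" "(- real q) ^ n \<noteq> - 1" "(- real q) ^ n \<noteq> - real q" "(- real q) ^ n \<noteq> real q"
proof -
  have "real q ^ n > real q ^ 1"
    using q_gt_1 assms by (intro power_strict_increasing) auto
  hence "real q ^ n > real q" by simp
  moreover have "(- real q) ^ n = real q ^ n \<or> (- real q) ^ n = - (real q ^ n)"
    by (cases "even n") auto
  moreover have "real q > 1" using q_gt_1 by simp
  ultimately show "(- real q) ^ n \<noteq> 1" "(- real q) ^ n \<noteq> - 1" "(- real q) ^ n \<noteq> - real q"
      "(- real q) ^ n \<noteq> real q"
    by linarith+
qed

text \<open>The image of \<open>x\<close> runs uniformly through the nonzero vectors. With
  \<open>s = (- q)^n\<close>, the factor \<open>s - 1\<close> is common to their number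
  \<open>s^2 - 1\<close> and to the sum of \<open>psi\<close> over them, and cancels.\<close>

lemma sum_GL_psi_rank_1:
  assumes "n \<ge> 2" "a \<in> fixed_field" "a \<noteq> 0" "x \<in> carrier_vec n" "x \<noteq> 0\<^sub>v n"
  shows "((- real q) ^ n + 1) * (\<Sum>g\<in>GL n. psi (a * herm (g *\<^sub>v x))) =
    real (card (GL n :: 'a mat set)) * (real q - 1)"
proof -
  define s where "s = (- real q) ^ n"
  have s: "s \<noteq> 1" using minus_q_power_not[OF assms(1)] by (simp add: s_def)
  have "(s\<^sup>2 - 1) * (\<Sum>g\<in>GL n. psi (a * herm (g *\<^sub>v x))) =
      real (card (GL n :: 'a mat set)) * (\<Sum>w\<in>carrier_vec n - {0\<^sub>v n}. psi (a * herm w))"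
    unfolding s_def card_nonzero_vec[symmetric] using assms by (intro sum_GL_nonzero) simp
  also have "(\<Sum>w\<in>carrier_vec n - {0\<^sub>v n}. psi (a * herm w)) = (real q - 1) * (s - 1)"
    using sum_psi_herm_nonzero[OF assms(2), of n] assms(3) by (simp add: s_def)
  finally have "(s - 1) * ((s + 1) * (\<Sum>g\<in>GL n. psi (a * herm (g *\<^sub>v x)))) =
      (s - 1) * (real (card (GL n :: 'a mat set)) * (real q - 1))"
    by (simp add: algebra_simps power2_eq_square)
  thus ?thesis using s by (simp add: s_def)
qed

text \<open>The image of the pair runs uniformly through the independent pairs; their number and the
  sum of \<open>psi\<close> over them share the factor \<open>(s - 1) (s + q)\<close>.\<close>

lemma sum_GL_psi_rank_2:
  fixes n :: nat
  assumes "n \<ge> 2" "a \<in> fixed_field" "a \<noteq> 0" "b \<in> fixed_field" "b \<noteq> 0" "(x, y) \<in> indep_pairs n"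
  defines "s \<equiv> (- real q) ^ n"
  shows "(s + 1) * (s - real q) * (\<Sum>g\<in>GL n. psi (a * herm (g *\<^sub>v x) + b * herm (g *\<^sub>v y))) =
    - real (card (GL n :: 'a mat set)) * (real q - 1) * real q"
proof -
  define X where "X = (\<Sum>g\<in>GL n. psi (a * herm (g *\<^sub>v x) + b * herm (g *\<^sub>v y)))"
  define G where "G = real (card (GL n :: 'a mat set))"
  define r where "r = real q"
  have "real (card (indep_pairs n :: ('a vec \<times> 'a vec) set)) * X =
      G * (\<Sum>(x, y)\<in>indep_pairs n. psi (a * herm x + b * herm y))"
    unfolding X_def G_def by (rule sum_GL_indep_pairs[OF assms(6)])
  hence "(s\<^sup>2 - 1) * (s\<^sup>2 - r\<^sup>2) * X = G * (- (r - 1) * r * (s - 1) * (s + r))"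
    unfolding card_indep_pairs sum_psi_indep_pairs[OF assms(2-5)] s_def r_def .
  hence "((s - 1) * (s + r)) * ((s + 1) * (s - r) * X) = ((s - 1) * (s + r)) * (- G * (r - 1) * r)"
    by (simp add: power2_eq_square algebra_simps)
  \<comment> \<open>Cancelling needs \<open>n \<ge> 2\<close>: for \<open>n = 1\<close> the factor
    \<open>s + q\<close> is zero.\<close>
  moreover have "(s - 1) * (s + r) \<noteq> 0"
    using minus_q_power_not[OF assms(1)] by (auto simp: s_def r_def add_eq_0_iff2)
  ultimately have "(s + 1) * (s - r) * X = - G * (r - 1) * r"
    by (metis mult_left_cancel)
  thus ?thesis unfolding X_def G_def r_def .
qed

end

section \<open>Hermitian matrices of rank at most two\<close>

lemma (in vec_space) card_lin_indpt_le_rank: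
  assumes A: "A \<in> carrier_mat n m" and S: "S \<subseteq> (*\<^sub>v) A ` carrier_vec m" and li: "lin_indpt S"
  shows "card S \<le> rank A"
proof -
  let ?W = "span (set (cols A))"
  have cols: "set (cols A) \<subseteq> carrier_vec n" using cols_dim A by blast
  have "S \<subseteq> ?W"
    using S A col_space_eq[of A m] unfolding col_space_def by auto
  have sub: "submodule class_ring ?W V" by (rule span_is_submodule) (use cols in simp)
  have vs: "vectorspace class_ring (vs ?W)"
    using cols span_is_subspace subspace_is_vs by simp
  have "LinearCombinations.module.lin_indpt class_ring (vs ?W) S"
    using span_li_not_depend(2)[OF \<open>S \<subseteq> ?W\<close> sub] li by simp
  thus ?thesis
    unfolding rank_def
    using vectorspace.li_le_dim(2)[OF vs fin_dim_span_cols[OF A], of S] \<open>S \<subseteq> ?W\<close> by simp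
qed

text \<open>The kernel of \<open>f\<close> contains the span of \<open>S\<close> but not
  \<open>w\<close>. Repeated use proves independence from a triangular array of values of
  functionals.\<close>

lemma (in vec_space) lin_indpt_insert_functional:
  assumes S: "S \<subseteq> carrier_vec n" "lin_indpt S" and w: "w \<in> carrier_vec n"
    and f: "f \<in> carrier_vec n" "\<And>s. s \<in> S \<Longrightarrow> f \<bullet> s = 0" "f \<bullet> w \<noteq> 0"
  shows "lin_indpt (insert w S) \<and> w \<notin> S"
proof -
  let ?N = "{y \<in> carrier_vec n. f \<bullet> y = 0}"
  have "submodule class_ring ?N V"
    by unfold_locales (use f(1) in \<open>auto simp: scalar_prod_add_distrib[of _ n] class_ring_simps\<close>)
  hence "span S \<subseteq> ?N"
    by (intro span_is_subset) (use S(1) f(2) in auto)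
  hence "w \<notin> span S" using f(3) by auto
  moreover have "w \<notin> S" using f by auto
  ultimately show ?thesis
    using lin_dep_iff_in_span[of S w] S w by simp
qed

section \<open>Diagonalisation of Hermitian matrices\<close>

context conj_field
begin

text \<open>The standard sesquilinear form, conjugate-linear in the first argument;
  \<open>herm w\<close> is its value at \<open>x = y = w\<close>.\<close>

definition sip :: "nat \<Rightarrow> 'a vec \<Rightarrow> 'a vec \<Rightarrow> 'a" where
  "sip n x y = (\<Sum>i<n. (x $ i) ^ q * y $ i)"

text \<open>The matrix \<open>a w w^H\<close>, where \<open>H\<close> is the conjugate transpose:
  the building block of the diagonalisation, with \<open>a\<close> taken from the fixed
  field.\<close>

definition dyad :: "'a \<Rightarrow> 'a vec \<Rightarrow> 'a mat" where
  "dyad a w = mat (dim_vec w) (dim_vec w) (\<lambda>(k, l). a * w $ k * (w $ l) ^ q)"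

lemma hermitian_entry:
  "A \<in> hermitian_mats n q \<Longrightarrow> i < n \<Longrightarrow> j < n \<Longrightarrow> (A $$ (i, j)) ^ q = (A :: 'a mat) $$ (j, i)"
proof -
  assume A: "A \<in> hermitian_mats n q" and ij: "i < n" "j < n"
  hence "conj_transpose q A $$ (j, i) = A $$ (j, i)" "A \<in> carrier_mat n n"
    by (auto simp: hermitian_mats_def)
  moreover from this have "conj_transpose q A $$ (j, i) = (A $$ (i, j)) ^ q"
    using ij by (simp add: conj_transpose_def)
  ultimately show ?thesis by simp
qed

lemma hermitian_matsI:
  assumes "A \<in> carrier_mat n n" "\<And>i j. i < n \<Longrightarrow> j < n \<Longrightarrow> (A $$ (i, j)) ^ q = (A :: 'a mat) $$ (j, i)"
  shows "A \<in> hermitian_mats n q"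
  using assms by (auto simp: hermitian_mats_def conj_transpose_def intro!: eq_matI)

lemma hermitian_carrier: "A \<in> hermitian_mats n q \<Longrightarrow> A \<in> carrier_mat n n"
  by (simp add: hermitian_mats_def)

lemma hermitian_diff:
  assumes "A \<in> hermitian_mats n q" "B \<in> hermitian_mats n q"
  shows "A - B \<in> (hermitian_mats n q :: 'a mat set)"
  using hermitian_carrier[OF assms(1)] hermitian_carrier[OF assms(2)]
  by (intro hermitian_matsI)
     (auto simp: conj_diff hermitian_entry[OF assms(1)] hermitian_entry[OF assms(2)])

lemma dyad_hermitian:
  assumes "w \<in> carrier_vec n" "a \<in> fixed_field"
  shows "dyad a w \<in> hermitian_mats n q"
  using assms by (intro hermitian_matsI)
    (auto simp: dyad_def power_mult_distrib conj_conj fixed_field_def)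

lemma sip_conj: "(sip n x y) ^ q = sip n y x"
  by (simp add: sip_def conj_sum power_mult_distrib conj_conj mult.commute)

lemma mult_vec_index:
  "A \<in> carrier_mat n n \<Longrightarrow> v \<in> carrier_vec n \<Longrightarrow> i < n \<Longrightarrow> (A *\<^sub>v v) $ i = (\<Sum>j<n. (A :: 'a mat) $$ (i, j) * v $ j)"
  by (simp add: scalar_prod_def atLeast0LessThan)

lemma sip_hermitian:
  assumes "A \<in> hermitian_mats n q" "x \<in> carrier_vec n" "y \<in> carrier_vec n"
  shows "sip n x (A *\<^sub>v y) = sip n (A *\<^sub>v x) y"
proof -
  note A = hermitian_carrier[OF assms(1)]
  have "sip n x (A *\<^sub>v y) = (\<Sum>i<n. \<Sum>j<n. (x $ i) ^ q * (A $$ (i, j) * y $ j))"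
    unfolding sip_def sum_distrib_left[symmetric]
    by (intro sum.cong refl) (simp add: mult_vec_index[OF A assms(3)] del: index_mult_mat_vec)
  also have "\<dots> = (\<Sum>j<n. \<Sum>i<n. (x $ i) ^ q * (A $$ (i, j) * y $ j))"
    by (rule sum.swap)
  also have "\<dots> = (\<Sum>j<n. ((A *\<^sub>v x) $ j) ^ q * y $ j)"
  proof (intro sum.cong refl)
    fix j assume j: "j \<in> {..<n}"
    have "((A *\<^sub>v x) $ j) ^ q * y $ j = (\<Sum>i<n. (A $$ (j, i)) ^ q * (x $ i) ^ q * y $ j)"
      using j by (simp add: mult_vec_index[OF A assms(2)] conj_sum power_mult_distrib
          sum_distrib_right del: index_mult_mat_vec)
    also have "\<dots> = (\<Sum>i<n. (x $ i) ^ q * (A $$ (i, j) * y $ j))"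
      using j by (intro sum.cong refl) (simp add: hermitian_entry[OF assms(1)])
    finally show "(\<Sum>i<n. (x $ i) ^ q * (A $$ (i, j) * y $ j)) = ((A *\<^sub>v x) $ j) ^ q * y $ j" ..
  qed
  finally show ?thesis by (simp add: sip_def)
qed

lemma sip_conv_scalar_prod:
  "y \<in> carrier_vec n \<Longrightarrow> sip n x y = vec n (\<lambda>i. (x $ i) ^ q) \<bullet> y"
  by (simp add: sip_def scalar_prod_def atLeast0LessThan)

lemma dyad_mult_vec:
  assumes "w \<in> carrier_vec n" "u \<in> carrier_vec n"
  shows "dyad a w *\<^sub>v u = (a * sip n w u) \<cdot>\<^sub>v w"
proof (rule eq_vecI)
  fix i assume "i < dim_vec ((a * sip n w u) \<cdot>\<^sub>v w)"
  hence i: "i < n" using assms by simp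
  have "dyad a w \<in> carrier_mat n n" using assms by (simp add: dyad_def)
  hence "(dyad a w *\<^sub>v u) $ i = (\<Sum>j<n. dyad a w $$ (i, j) * u $ j)"
    using assms(2) i by (rule mult_vec_index)
  also have "\<dots> = (\<Sum>j<n. a * ((w $ j) ^ q * u $ j) * w $ i)"
    using assms(1) i by (intro sum.cong refl) (simp add: dyad_def)
  also have "\<dots> = a * sip n w u * w $ i"
    unfolding sip_def sum_distrib_left sum_distrib_right ..
  finally show "(dyad a w *\<^sub>v u) $ i = ((a * sip n w u) \<cdot>\<^sub>v w) $ i"
    using assms i by simp
qed (use assms in \<open>simp add: dyad_def\<close>)

text \<open>A nonzero diagonal entry is the value at a unit vector. If the diagonal vanishes, a
  combination of two unit vectors yields a trace \<open>x + x^q\<close>, which can be made nonzero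
  in every characteristic.\<close>

lemma hermitian_exists_sip_nonzero:
  assumes A: "A \<in> hermitian_mats n q" "A \<noteq> 0\<^sub>m n n"
  shows "\<exists>v\<in>carrier_vec n. sip n v (A *\<^sub>v v) \<noteq> 0"
proof -
  note c = hermitian_carrier[OF A(1)]
  have unit: "sip n (unit_vec n i) y = y $ i" if "i < n" for i y
  proof -
    have "sip n (unit_vec n i) y = (\<Sum>k<n. if k = i then y $ k else 0)"
      unfolding sip_def using that by (intro sum.cong refl) (auto simp: unit_vec_def conj_zero)
    thus ?thesis using that by simp
  qed
  show ?thesis
  proof (cases "\<exists>i<n. A $$ (i, i) \<noteq> 0")
    case True
    then obtain i where i: "i < n" "A $$ (i, i) \<noteq> 0" by blast
    have "sip n (unit_vec n i) (A *\<^sub>v unit_vec n i) = A $$ (i, i)"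
      using i(1) c by (simp add: unit)
    thus ?thesis using i by (intro bexI[of _ "unit_vec n i"]) auto
  next
    case False
    obtain i j where ij: "i < n" "j < n" "A $$ (i, j) \<noteq> 0"
      using A(2) c by (metis carrier_matD eq_matI index_zero_mat)
    have ne: "i \<noteq> j" using False ij by auto
    obtain x :: 'a where x: "x + x ^ q \<noteq> 0" using exists_trace_nonzero by blast
    \<comment> \<open>Chosen so that \<open>c'^q A_ij = x\<close> and, as
      \<open>A_ji = A_ij^q\<close>, also \<open>c' A_ji = x^q\<close>.\<close>
    define c' where "c' = (x / A $$ (i, j)) ^ q"
    define v where "v = c' \<cdot>\<^sub>v unit_vec n i + unit_vec n j"
    have v: "v \<in> carrier_vec n" by (simp add: v_def)
    have sv: "sip n v y = c' ^ q * y $ i + y $ j" if "y \<in> carrier_vec n" for y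
    proof -
      have "sip n v y = (\<Sum>k<n. (if k = i then c' ^ q * y $ k else 0) + (if k = j then y $ k else 0))"
        unfolding sip_def v_def using ij ne
        by (intro sum.cong refl) (auto simp: unit_vec_def conj_zero)
      thus ?thesis using ij by (simp add: sum.distrib)
    qed
    have Av: "A *\<^sub>v v = c' \<cdot>\<^sub>v col A i + col A j"
      using c ij by (intro eq_vecI) (auto simp: v_def scalar_prod_add_distrib[of _ n])
    have "sip n v (A *\<^sub>v v) = c' ^ q * A $$ (i, j) + c' * A $$ (j, i)"
      unfolding Av using c ij False by (subst sv) auto
    also have "c' ^ q * A $$ (i, j) = x"
      using ij(3) by (simp add: c'_def conj_conj)
    also have "c' * A $$ (j, i) = x ^ q"
      using ij(3) unfolding hermitian_entry[OF A(1) ij(1,2), symmetric]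
      by (simp add: c'_def power_divide)
    finally have "sip n v (A *\<^sub>v v) \<noteq> 0" using x by simp
    thus ?thesis using v by blast
  qed
qed

text \<open>One step of the diagonalisation. The value \<open>s = v^H A v\<close> lies in the fixed
  field by self-adjointness; subtracting \<open>s^-1 (A v) (A v)^H\<close> leaves a Hermitian matrix
  with \<open>v\<close> in its kernel. The last clause lets \<open>v\<close> serve as a functional
  that is nonzero on \<open>A v\<close>.\<close>

lemma hermitian_split:
  assumes A: "A \<in> hermitian_mats n q" "A \<noteq> 0\<^sub>m n n"
  obtains v a where "v \<in> carrier_vec n" "a \<in> fixed_field" "a \<noteq> 0"
    "A - dyad a (A *\<^sub>v v) \<in> hermitian_mats n q" "(A - dyad a (A *\<^sub>v v)) *\<^sub>v v = 0\<^sub>v n"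
    "sip n v (A *\<^sub>v v) \<noteq> 0"
proof -
  note c = hermitian_carrier[OF A(1)]
  obtain v where v: "v \<in> carrier_vec n" "sip n v (A *\<^sub>v v) \<noteq> 0"
    using hermitian_exists_sip_nonzero[OF A] by blast
  define s where "s = sip n v (A *\<^sub>v v)"
  have sym: "sip n (A *\<^sub>v v) v = s"
    using sip_hermitian[OF A(1) v(1) v(1)] by (simp add: s_def)
  have s: "s \<in> fixed_field" "s \<noteq> 0"
    using sip_conj[of n v "A *\<^sub>v v"] sym v(2) by (auto simp: s_def fixed_field_def)
  have w: "A *\<^sub>v v \<in> carrier_vec n" using c v by simp
  have "(A - dyad (inverse s) (A *\<^sub>v v)) *\<^sub>v v = A *\<^sub>v v - dyad (inverse s) (A *\<^sub>v v) *\<^sub>v v"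
    using c v hermitian_carrier[OF dyad_hermitian[OF w fixed_inverse[OF s(1)]]]
    by (intro minus_mult_distrib_mat_vec[of _ n n]) auto
  also have "\<dots> = 0\<^sub>v n"
    using w s v by (simp add: dyad_mult_vec[OF w v(1)] sym)
  finally show ?thesis
    using that[of v "inverse s"] v s A w
    by (auto intro: fixed_inverse hermitian_diff dyad_hermitian)
qed

text \<open>Unless the first remainder is already zero, splitting twice gives
  \<open>A = a w w^H + b w' w'^H + C\<close>. If \<open>C\<close> were nonzero, a vector of its
  range would join \<open>w\<close> and \<open>w'\<close> as a third independent vector in the range
  of \<open>A\<close>.\<close>

lemma hermitian_rank_le_2:
  assumes A: "A \<in> hermitian_mats n q" "A \<noteq> 0\<^sub>m n n" "vec_space.rank n A \<le> 2"
  shows "(\<exists>a\<in>fixed_field. \<exists>w\<in>carrier_vec n. a \<noteq> 0 \<and> w \<noteq> 0\<^sub>v n \<and> A = dyad a w) \<or>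
    vec_space.rank n A = 2 \<and> (\<exists>a\<in>fixed_field. \<exists>b\<in>fixed_field. \<exists>(w, z)\<in>indep_pairs n.
      a \<noteq> 0 \<and> b \<noteq> 0 \<and> A = dyad a w + dyad b z)"
proof -
  interpret vec_space "TYPE('a)" n .
  note c = hermitian_carrier[OF A(1)]
  have z: "0\<^sub>v n \<noteq> y" if "sip n x y \<noteq> 0" for x y
    using that by (auto simp: sip_def)
  obtain v a where v: "v \<in> carrier_vec n" "a \<in> fixed_field" "a \<noteq> 0"
    "A - dyad a (A *\<^sub>v v) \<in> hermitian_mats n q" "(A - dyad a (A *\<^sub>v v)) *\<^sub>v v = 0\<^sub>v n"
    "sip n v (A *\<^sub>v v) \<noteq> 0"
    using hermitian_split[OF A(1,2)] .
  define w where "w = A *\<^sub>v v"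
  define B where "B = A - dyad a w"
  have w: "w \<in> carrier_vec n" using c v by (simp add: w_def)
  have dw: "dyad a w \<in> carrier_mat n n" using hermitian_carrier[OF dyad_hermitian[OF w v(2)]] .
  have B: "B \<in> hermitian_mats n q" "B *\<^sub>v v = 0\<^sub>v n" "sip n v w \<noteq> 0"
    using v by (simp_all add: B_def w_def)
  note cB = hermitian_carrier[OF B(1)]
  have Bu: "B *\<^sub>v u = A *\<^sub>v u - (a * sip n w u) \<cdot>\<^sub>v w" if "u \<in> carrier_vec n" for u
    using that c dw w by (simp add: B_def minus_mult_distrib_mat_vec[of _ n n] dyad_mult_vec[of _ n])
  have AB: "A = dyad a w + B"
    using c dw by (intro eq_matI) (auto simp: B_def)
  \<comment> \<open>\<open>B\<close> is self-adjoint and kills \<open>v\<close>, so its whole range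
    is orthogonal to \<open>v\<close>, whereas \<open>w\<close> is not.\<close>
  have Bv0: "sip n v (B *\<^sub>v u) = 0" if "u \<in> carrier_vec n" for u
    using sip_hermitian[OF B(1) v(1) that] B(2) by (simp add: sip_def conj_zero)
  \<comment> \<open>As \<open>w = A v\<close>, correcting by multiples of \<open>w\<close> does not
    leave the range of \<open>A\<close>; so values of \<open>B\<close>, and later of
    \<open>C\<close>, still lie in it.\<close>
  have in_range: "A *\<^sub>v u - c \<cdot>\<^sub>v w \<in> (*\<^sub>v) A ` carrier_vec n" if "u \<in> carrier_vec n" for u c
    using that \<open>A \<in> carrier_mat n n\<close> v(1)
    by (intro image_eqI[of _ _ "u - c \<cdot>\<^sub>v v"])
       (simp_all add: w_def mult_minus_distrib_mat_vec[of _ n n] mult_mat_vec[of _ n n])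
  have range_w: "w \<in> (*\<^sub>v) A ` carrier_vec n" using v by (simp add: w_def)
  have ins: "lin_indpt (insert y S) \<and> y \<notin> S"
    if "S \<subseteq> carrier_vec n" "lin_indpt S" "y \<in> carrier_vec n" "\<And>s. s \<in> S \<Longrightarrow> sip n x s = 0" "sip n x y \<noteq> 0"
    for x y S
    using that(1,4)
    by (intro lin_indpt_insert_functional[of S y "vec n (\<lambda>i. (x $ i) ^ q)"] that)
       (auto simp: that(3,5) sip_conv_scalar_prod[symmetric] subset_iff)
  have empty: "lin_indpt {}" using finite_lin_indpt2[of "{}"] by auto
  show ?thesis
  proof (cases "B = 0\<^sub>m n n")
    case True
    hence "A = dyad a w" using AB dw by simp
    moreover have "w \<noteq> 0\<^sub>v n" using z[OF B(3)] by simp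
    ultimately show ?thesis using v(2,3) w by blast
  next
    case False
    obtain v' b where v': "v' \<in> carrier_vec n" "b \<in> fixed_field" "b \<noteq> 0"
      "B - dyad b (B *\<^sub>v v') \<in> hermitian_mats n q" "(B - dyad b (B *\<^sub>v v')) *\<^sub>v v' = 0\<^sub>v n"
      "sip n v' (B *\<^sub>v v') \<noteq> 0"
      using hermitian_split[OF B(1) False] .
    define w' where "w' = B *\<^sub>v v'"
    define C where "C = B - dyad b w'"
    have w': "w' \<in> carrier_vec n" using cB v' by (simp add: w'_def)
    have dw': "dyad b w' \<in> carrier_mat n n" using hermitian_carrier[OF dyad_hermitian[OF w' v'(2)]] .
    have C: "C \<in> hermitian_mats n q" "C *\<^sub>v v' = 0\<^sub>v n" "sip n v' w' \<noteq> 0"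
      using v' by (simp_all add: C_def w'_def)
    have vw': "sip n v w' = 0" using Bv0 v' by (simp add: w'_def)
    have range_w': "w' \<in> (*\<^sub>v) A ` carrier_vec n"
      using in_range[OF v'(1)] by (simp add: w'_def Bu[OF v'(1)])
    have "w' \<noteq> c \<cdot>\<^sub>v w" for c
    proof
      assume eq: "w' = c \<cdot>\<^sub>v w"
      hence "c * sip n v w = 0"
        using vw' w by (simp add: sip_def sum_distrib_left mult_ac)
      hence "w' = 0\<^sub>v n" using eq B(3) w by simp
      thus False using z[OF C(3)] by simp
    qed
    hence ind: "(w, w') \<in> indep_pairs n"
      using w w' z[OF B(3)] by (auto simp: indep_pairs_def)
    have li1: "lin_indpt {w'}" using ins[OF _ empty w' _ C(3)] by simp
    have li2: "lin_indpt {w, w'} \<and> w \<notin> {w'}" using ins[OF _ li1 w _ B(3)] w' vw' by simp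
    have "card {w, w'} \<le> rank A"
      using li2 range_w range_w' by (intro card_lin_indpt_le_rank[OF c]) auto
    hence rank: "rank A = 2" using A(3) li2 by simp
    have "C = 0\<^sub>m n n"
    proof (rule ccontr)
      assume "C \<noteq> 0\<^sub>m n n"
      then obtain v'' where v'': "v'' \<in> carrier_vec n" "sip n v'' (C *\<^sub>v v'') \<noteq> 0"
        using hermitian_exists_sip_nonzero[OF C(1)] by blast
      let ?y = "C *\<^sub>v v''"
      have y: "?y \<in> carrier_vec n" using hermitian_carrier[OF C(1)] v'' by simp
      have Cu: "C *\<^sub>v u = B *\<^sub>v u - (b * sip n w' u) \<cdot>\<^sub>v w'" if "u \<in> carrier_vec n" for u
        using that cB dw' w'
        by (simp add: C_def minus_mult_distrib_mat_vec[of _ n n] dyad_mult_vec[of _ n])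
      \<comment> \<open>\<open>C\<close> also kills \<open>v\<close>, because \<open>B\<close> does
        and \<open>w'\<close> is orthogonal to \<open>v\<close>. Hence the range of \<open>C\<close>
        is orthogonal to both \<open>v\<close> and \<open>v'\<close>.\<close>
      have "sip n w' v = 0" using sip_conj[of n v w'] vw' conj_zero by simp
      hence "C *\<^sub>v v = 0\<^sub>v n" using Cu[OF v(1)] B(2) w' by simp
      hence vy: "sip n v ?y = 0"
        using sip_hermitian[OF C(1) v(1) v''(1)] by (simp add: sip_def conj_zero)
      have v'y: "sip n v' ?y = 0"
        using sip_hermitian[OF C(1) v'(1) v''(1)] C(2) by (simp add: sip_def conj_zero)
      let ?k = "b * sip n w' v''"
      have "?y = B *\<^sub>v (v'' - ?k \<cdot>\<^sub>v v')"
        using Cu[OF v''(1)] cB v' v''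
        by (simp add: w'_def mult_minus_distrib_mat_vec[of _ n n] mult_mat_vec[of _ n n])
      hence range_y: "?y \<in> (*\<^sub>v) A ` carrier_vec n"
        using in_range[of "v'' - ?k \<cdot>\<^sub>v v'"] Bu[of "v'' - ?k \<cdot>\<^sub>v v'"] v' v'' by simp
      \<comment> \<open>The triangular pattern: \<open>v''\<close> is nonzero on \<open>?y\<close>,
        \<open>v'\<close> separates \<open>w'\<close> from \<open>?y\<close>, and \<open>v\<close>
        separates \<open>w\<close> from both.\<close>
      have l1: "lin_indpt {?y}" using ins[OF _ empty y _ v''(2)] by simp
      have l2: "lin_indpt {w', ?y} \<and> w' \<notin> {?y}" using ins[OF _ l1 w' _ C(3)] y v'y by simp
      have l3: "lin_indpt {w, w', ?y} \<and> w \<notin> {w', ?y}"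
        using ins[OF _ conjunct1[OF l2] w _ B(3)] w' y vw' vy by auto
      have "card {w, w', ?y} \<le> rank A"
        using l3 range_w range_w' range_y by (intro card_lin_indpt_le_rank[OF c]) auto
      thus False using A(3) l2 l3 by simp
    qed
    moreover have "B = C + dyad b w'" using cB dw' by (intro eq_matI) (auto simp: C_def)
    ultimately have "B = dyad b w'" using dw' by simp
    hence "A = dyad a w + dyad b w'" using AB by simp
    thus ?thesis using rank ind v v' by blast
  qed
qed

end

section \<open>The averaging argument\<close>

context conj_field
begin

text \<open>The trace of \<open>g A g\<^sup>*\<close>.\<close>

definition hval :: "nat \<Rightarrow> 'a mat \<Rightarrow> 'a mat \<Rightarrow> 'a" where
  "hval n g A = (\<Sum>j<n. \<Sum>k<n. \<Sum>l<n. g $$ (j, k) * A $$ (k, l) * (g $$ (j, l)) ^ q)"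

lemma hval_add:
  "A \<in> carrier_mat n n \<Longrightarrow> B \<in> carrier_mat n n \<Longrightarrow> hval n g (A + B) = hval n g A + hval n g B"
  by (simp add: hval_def algebra_simps sum.distrib)

lemma hval_diff:
  "A \<in> carrier_mat n n \<Longrightarrow> B \<in> carrier_mat n n \<Longrightarrow> hval n g (A - B) = hval n g A - hval n g B"
  by (simp add: hval_def algebra_simps sum_subtractf)

lemma hval_zero: "hval n g (0\<^sub>m n n) = 0"
  by (simp add: hval_def)

text \<open>The diagonal entries of \<open>g w w^H g^H\<close> are the norms of the coordinates of
  \<open>g w\<close>.\<close>

lemma hval_dyad:
  assumes "g \<in> carrier_mat n n" "w \<in> carrier_vec n"
  shows "hval n g (dyad a w) = a * herm (g *\<^sub>v w)"
proof -
  have "(\<Sum>k<n. \<Sum>l<n. g $$ (j, k) * dyad a w $$ (k, l) * (g $$ (j, l)) ^ q) =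
      a * ((g *\<^sub>v w) $ j) ^ (q + 1)" if "j < n" for j
  proof -
    have "((g *\<^sub>v w) $ j) ^ (q + 1) =
        (\<Sum>k<n. g $$ (j, k) * w $ k) * (\<Sum>l<n. (g $$ (j, l)) ^ q * (w $ l) ^ q)"
      using that by (simp add: mult_vec_index[OF assms] conj_sum power_mult_distrib
          del: index_mult_mat_vec)
    also have "a * \<dots> = (\<Sum>k<n. \<Sum>l<n. a * (g $$ (j, k) * w $ k * ((g $$ (j, l)) ^ q * (w $ l) ^ q)))"
      by (simp only: sum_product) (simp only: sum_distrib_left)
    also have "\<dots> = (\<Sum>k<n. \<Sum>l<n. g $$ (j, k) * dyad a w $$ (k, l) * (g $$ (j, l)) ^ q)"
      using assms(2) by (intro sum.cong refl) (simp add: dyad_def)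
    finally show ?thesis ..
  qed
  thus ?thesis
    using assms unfolding hval_def herm_def by (simp add: sum_distrib_left)
qed

text \<open>Conjugation exchanges the roles of the indices \<open>k\<close> and
  \<open>l\<close>.\<close>

lemma hval_fixed:
  assumes "A \<in> hermitian_mats n q"
  shows "hval n g A \<in> fixed_field"
proof -
  have "(hval n g A) ^ q =
      (\<Sum>j<n. \<Sum>k<n. \<Sum>l<n. g $$ (j, l) * A $$ (l, k) * (g $$ (j, k)) ^ q)"
    unfolding hval_def conj_sum
    by (intro sum.cong refl) (simp add: power_mult_distrib conj_conj hermitian_entry[OF assms])
  also have "\<dots> = hval n g A"
    unfolding hval_def by (intro sum.cong refl sum.swap)
  finally show ?thesis by (simp add: fixed_field_def)
qed

text \<open>In Fourier-analytic terms, \<open>psi\<close> is a positive definite function on the fixed field.\<close>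

lemma sum_psi_diff_nonneg:
  assumes U: "finite U" and f: "\<And>x. x \<in> U \<Longrightarrow> f x \<in> fixed_field"
  shows "(\<Sum>x\<in>U. \<Sum>y\<in>U. psi (f x - f y)) \<ge> 0"
proof -
  \<comment> \<open>\<open>N c\<close> counts the elements of \<open>U\<close> with value
    \<open>c\<close>; the double sum of \<open>psi\<close> becomes \<open>q\<close> times the sum of
    the squares of \<open>N c\<close>, minus the square of \<open>card U\<close>.\<close>
  define N where "N c = (\<Sum>x\<in>U. of_bool (f x = c) :: real)" for c
  let ?K = "fixed_field" and ?u = "real (card U)" and ?r = "real q"
  have "(\<Sum>c\<in>?K. N c) = (\<Sum>x\<in>U. \<Sum>c\<in>?K. of_bool (f x = c))"
    unfolding N_def by (rule sum.swap)
  also have "\<dots> = (\<Sum>x\<in>U. 1)"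
  proof (intro sum.cong refl)
    fix x assume "x \<in> U"
    have "(\<Sum>c\<in>?K. of_bool (f x = c) :: real) = (\<Sum>c\<in>?K. if f x = c then 1 else 0)"
      by (intro sum.cong) auto
    thus "(\<Sum>c\<in>?K. of_bool (f x = c) :: real) = 1" using f[OF \<open>x \<in> U\<close>] by simp
  qed
  finally have N1: "(\<Sum>c\<in>?K. N c) = ?u" by simp
  have "(\<Sum>c\<in>?K. (N c)\<^sup>2) = (\<Sum>c\<in>?K. \<Sum>x\<in>U. \<Sum>y\<in>U. of_bool (f x = c) * of_bool (f y = c))"
    by (simp only: N_def power2_eq_square sum_product)
  also have "\<dots> = (\<Sum>x\<in>U. \<Sum>c\<in>?K. \<Sum>y\<in>U. of_bool (f x = c) * of_bool (f y = c))"
    by (rule sum.swap)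
  also have "\<dots> = (\<Sum>x\<in>U. \<Sum>y\<in>U. \<Sum>c\<in>?K. of_bool (f x = c) * of_bool (f y = c))"
    by (intro sum.cong refl sum.swap)
  also have "\<dots> = (\<Sum>x\<in>U. \<Sum>y\<in>U. of_bool (f x = f y))"
  proof (intro sum.cong refl)
    fix x y assume "x \<in> U" "y \<in> U"
    have "(\<Sum>c\<in>?K. of_bool (f x = c) * of_bool (f y = c) :: real) =
        (\<Sum>c\<in>?K. if f x = c then of_bool (f x = f y) else 0)"
      by (intro sum.cong) auto
    thus "(\<Sum>c\<in>?K. of_bool (f x = c) * of_bool (f y = c) :: real) = of_bool (f x = f y)"
      using f[OF \<open>x \<in> U\<close>] by simp
  qed
  finally have N2: "(\<Sum>c\<in>?K. (N c)\<^sup>2) = (\<Sum>x\<in>U. \<Sum>y\<in>U. of_bool (f x = f y))" .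
  \<comment> \<open>Cauchy-Schwarz in expanded form: squared deviations of \<open>N c\<close> from
    \<open>card U / q\<close>, scaled by \<open>q\<close>, over at most \<open>q\<close> values
    \<open>c\<close>.\<close>
  have "0 \<le> (\<Sum>c\<in>?K. (?r * N c - ?u)\<^sup>2)"
    by (intro sum_nonneg) simp
  also have "\<dots> = (\<Sum>c\<in>?K. ?r\<^sup>2 * (N c)\<^sup>2 - 2 * ?r * ?u * N c + ?u\<^sup>2)"
    by (intro sum.cong refl) (simp add: power2_eq_square algebra_simps)
  also have "\<dots> = ?r\<^sup>2 * (\<Sum>c\<in>?K. (N c)\<^sup>2) - 2 * ?r * ?u * (\<Sum>c\<in>?K. N c) + real (card ?K) * ?u\<^sup>2"
    by (simp add: sum.distrib sum_subtractf sum_distrib_left)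
  also have "\<dots> \<le> ?r\<^sup>2 * (\<Sum>c\<in>?K. (N c)\<^sup>2) - 2 * ?r * ?u * (\<Sum>c\<in>?K. N c) + ?r * ?u\<^sup>2"
    using card_fixed_le by (intro add_left_mono mult_right_mono) auto
  also have "\<dots> = ?r * (?r * (\<Sum>c\<in>?K. (N c)\<^sup>2) - ?u\<^sup>2)"
    unfolding N1 by (simp add: power2_eq_square algebra_simps)
  finally have "?r * (\<Sum>c\<in>?K. (N c)\<^sup>2) - ?u\<^sup>2 \<ge> 0"
    using q_gt_1 by (simp add: zero_le_mult_iff)
  also have "?r * (\<Sum>c\<in>?K. (N c)\<^sup>2) - ?u\<^sup>2 = (\<Sum>x\<in>U. \<Sum>y\<in>U. psi (f x - f y))"
    unfolding N2 psi_conv by (simp add: sum_subtractf sum_distrib_left power2_eq_square)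
  finally show ?thesis .
qed

text \<open>For odd \<open>n\<close> the quantity \<open>s = (- q)^n\<close> is
  \<open>- (q^n)\<close>. With two dyads, \<open>(s + 1) (s - q) = q D\<close> gives equality; with
  a single dyad, \<open>D\<close> times the sum is \<open>- G (q - 1) (q^(n-1) + 1)\<close>,
  strictly smaller. So equality identifies rank two.\<close>

lemma GL_sum_psi_le:
  fixes n :: nat
  defines "G \<equiv> real (card (GL n :: 'a mat set))"
    and "D \<equiv> (real q ^ n - 1) * (real q ^ (n - 1) + 1)"
  assumes n: "n \<ge> 2" "odd n"
    and A: "A \<in> hermitian_mats n q" "A \<noteq> 0\<^sub>m n n" "vec_space.rank n A \<le> 2"
  shows "D * (\<Sum>g\<in>GL n. psi (hval n g A)) \<le> - G * (real q - 1)"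
    and "D * (\<Sum>g\<in>GL n. psi (hval n g A)) = - G * (real q - 1) \<Longrightarrow> vec_space.rank n A = 2"
proof -
  define S where "S = (\<Sum>g\<in>GL n. psi (hval n g A))"
  define r where "r = real q"
  define Q where "Q = r ^ n"
  define P where "P = r ^ (n - 1)"
  have r: "r > 1" using q_gt_1 by (simp add: r_def)
  have QP: "Q = r * P" using n(1) by (cases n) (auto simp: Q_def P_def)
  have P: "P > 0" using r by (simp add: P_def)
  have Q: "Q > 1" using r n(1) by (simp add: Q_def)
  have odd: "(- real q) ^ n = - Q" using n(2) by (simp add: Q_def r_def)
  have "(GL n :: 'a mat set) \<noteq> {}" using one_GL by blast
  hence G: "G > 0" using finite_GL by (simp add: G_def card_gt_0_iff)
  have D: "D = (Q - 1) * (P + 1)" by (simp add: D_def Q_def P_def r_def)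
  have "(D * S \<le> - G * (r - 1)) \<and> (D * S = - G * (r - 1) \<longrightarrow> vec_space.rank n A = 2)"
    using hermitian_rank_le_2[OF A]
  proof (elim disjE)
    assume "\<exists>a\<in>fixed_field. \<exists>w\<in>carrier_vec n. a \<noteq> 0 \<and> w \<noteq> 0\<^sub>v n \<and> A = dyad a w"
    then obtain a w where aw: "a \<in> fixed_field" "a \<noteq> 0" "w \<in> carrier_vec n" "w \<noteq> 0\<^sub>v n" "A = dyad a w"
      by blast
    have "S = (\<Sum>g\<in>GL n. psi (a * herm (g *\<^sub>v w)))"
      unfolding S_def aw(5) by (intro sum.cong refl arg_cong[of _ _ psi] hval_dyad GL_carrier aw(3))
    hence "(- Q + 1) * S = G * (r - 1)"
      using sum_GL_psi_rank_1[OF n(1) aw(1-4)] unfolding odd G_def r_def by simp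
    hence "(Q - 1) * S = - (G * (r - 1))"
      by (simp add: algebra_simps)
    hence "D * S = - (G * (r - 1)) * (P + 1)"
      unfolding D by (metis mult.assoc mult.commute)
    moreover have "G * (r - 1) * P > 0" using G r P by simp
    ultimately have "D * S < - G * (r - 1)" by (simp add: algebra_simps)
    thus ?thesis by simp
  next
    assume "vec_space.rank n A = 2 \<and> (\<exists>a\<in>fixed_field. \<exists>b\<in>fixed_field. \<exists>(w, z)\<in>indep_pairs n.
      a \<noteq> 0 \<and> b \<noteq> 0 \<and> A = dyad a w + dyad b z)"
    then obtain a b w z where rank: "vec_space.rank n A = 2"
      and ab: "a \<in> fixed_field" "a \<noteq> 0" "b \<in> fixed_field" "b \<noteq> 0" "(w, z) \<in> indep_pairs n"
        "A = dyad a w + dyad b z"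
      by blast
    have wz: "w \<in> carrier_vec n" "z \<in> carrier_vec n" using ab(5) by (auto simp: indep_pairs_def)
    have "hval n g A = a * herm (g *\<^sub>v w) + b * herm (g *\<^sub>v z)" if "g \<in> GL n" for g
      unfolding ab(6) using GL_carrier[OF that] wz ab(1,3)
      by (subst hval_add) (auto simp: hval_dyad intro: hermitian_carrier dyad_hermitian)
    hence "S = (\<Sum>g\<in>GL n. psi (a * herm (g *\<^sub>v w) + b * herm (g *\<^sub>v z)))"
      unfolding S_def by simp
    hence "(- Q + 1) * (- Q - r) * S = - G * (r - 1) * r"
      using sum_GL_psi_rank_2[OF n(1) ab(1-5)] unfolding odd G_def r_def by simp
    moreover have "(- Q + 1) * (- Q - r) = r * D"
      unfolding D QP by (simp add: algebra_simps)
    ultimately have "r * (D * S) = r * (- G * (r - 1))"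
      by (simp add: mult_ac)
    hence "D * S = - G * (r - 1)" using r by (metis mult_left_cancel less_numeral_extra(1) less_trans less_irrefl)
    thus ?thesis using rank by simp
  qed
  thus "D * (\<Sum>g\<in>GL n. psi (hval n g A)) \<le> - G * (real q - 1)"
    and "D * (\<Sum>g\<in>GL n. psi (hval n g A)) = - G * (real q - 1) \<Longrightarrow> vec_space.rank n A = 2"
    by (auto simp: S_def r_def)
qed

text \<open>A linear programming argument: in \<open>D\<close> times a nonnegative double sum, each
  pair \<open>x \<noteq> y\<close> contributes at most \<open>- G\<close> and each diagonal pair
  contributes \<open>D G\<close>. For nonempty \<open>U\<close> this forces
  \<open>card U - 1 \<le> D\<close>.\<close>

lemma hermitian_rank_distance_le_2:
  fixes n :: nat and U :: "'a mat set"
  defines "D \<equiv> (real q ^ n - 1) * (real q ^ (n - 1) + 1)"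
  assumes n: "n \<ge> 2" "odd n" and U: "U \<subseteq> hermitian_mats n q"
    and rank: "\<And>x y. x \<in> U \<Longrightarrow> y \<in> U \<Longrightarrow> vec_space.rank n (x - y) \<le> 2"
  shows "real (card U) \<le> D + 1"
    and "real (card U) = D + 1 \<Longrightarrow> x \<in> U \<Longrightarrow> y \<in> U \<Longrightarrow> x \<noteq> y \<Longrightarrow> vec_space.rank n (x - y) = 2"
proof -
  define G where "G = real (card (GL n :: 'a mat set)) * (real q - 1)"
  define S where "S A = (\<Sum>g\<in>GL n. psi (hval n g A))" for A
  \<comment> \<open>The gap between the upper bound for \<open>D * S (x - y)\<close> and its value.
    On the diagonal it is zero, because \<open>psi 0 = q - 1\<close> is the factor that
    \<open>G\<close> includes here.\<close>
  define e where "e x y = (if x = y then D * G else - G) - D * S (x - y)" for x y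
  let ?u = "real (card U)"
  have car: "x \<in> carrier_mat n n" if "x \<in> U" for x
    using that U hermitian_carrier by blast
  have fin: "finite U"
    by (rule finite_subset[OF _ finite_carrier_mat[of n n]]) (use car in auto)
  have "(GL n :: 'a mat set) \<noteq> {}" using one_GL by blast
  hence "card (GL n :: 'a mat set) > 0" using finite_GL by (simp add: card_gt_0_iff)
  hence G: "G > 0" using q_gt_1 unfolding G_def by (intro mult_pos_pos) auto
  have D: "D \<ge> 0" using q_gt_1 unfolding D_def by (intro mult_nonneg_nonneg) auto
  have ne: "x - y \<noteq> 0\<^sub>m n n" if "x \<in> U" "y \<in> U" "x \<noteq> y" for x y
  proof
    assume *: "x - y = 0\<^sub>m n n"
    have "x $$ (i, j) = y $$ (i, j)" if "i < n" "j < n" for i j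
      using arg_cong[OF *, of "\<lambda>A. A $$ (i, j)"] that car[OF \<open>y \<in> U\<close>] by simp
    hence "x = y" using car \<open>x \<in> U\<close> \<open>y \<in> U\<close> by (intro eq_matI) (metis carrier_matD)+
    thus False using \<open>x \<noteq> y\<close> by simp
  qed
  have e_nonneg: "e x y \<ge> 0" if "x \<in> U" "y \<in> U" for x y
  proof (cases "x = y")
    case True
    have "x - x = 0\<^sub>m n n" using car[OF that(1)] by simp
    thus ?thesis using True by (simp add: e_def S_def hval_zero psi_def G_def)
  next
    case False
    thus ?thesis
      using GL_sum_psi_le(1)[OF n hermitian_diff ne[OF that False] rank[OF that]] U that
      by (auto simp: e_def S_def D_def G_def)
  qed
  have S_nonneg: "(\<Sum>x\<in>U. \<Sum>y\<in>U. S (x - y)) \<ge> 0"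
  proof -
    have "(\<Sum>x\<in>U. \<Sum>y\<in>U. S (x - y)) = (\<Sum>x\<in>U. \<Sum>g\<in>GL n. \<Sum>y\<in>U. psi (hval n g (x - y)))"
      unfolding S_def by (intro sum.cong refl sum.swap)
    also have "\<dots> = (\<Sum>g\<in>GL n. \<Sum>x\<in>U. \<Sum>y\<in>U. psi (hval n g (x - y)))"
      by (rule sum.swap)
    also have "\<dots> = (\<Sum>g\<in>GL n. \<Sum>x\<in>U. \<Sum>y\<in>U. psi (hval n g x - hval n g y))"
      by (intro sum.cong refl) (simp add: hval_diff car)
    also have "\<dots> \<ge> 0"
      using U by (intro sum_nonneg sum_psi_diff_nonneg fin hval_fixed) auto
    finally show ?thesis .
  qed
  have "(\<Sum>x\<in>U. \<Sum>y\<in>U. if x = y then D * G else - G) = (\<Sum>x\<in>U. D * G - (?u - 1) * G)"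
  proof (intro sum.cong refl)
    fix x assume x: "x \<in> U"
    have "(\<Sum>y\<in>U. if x = y then D * G else - G) = (\<Sum>y\<in>U. (if x = y then (D + 1) * G else 0) - G)"
      by (intro sum.cong) (auto simp: algebra_simps)
    thus "(\<Sum>y\<in>U. if x = y then D * G else - G) = D * G - (?u - 1) * G"
      using x fin by (simp add: sum_subtractf algebra_simps)
  qed
  hence sum_e: "(\<Sum>x\<in>U. \<Sum>y\<in>U. e x y) = ?u * G * (D + 1 - ?u) - D * (\<Sum>x\<in>U. \<Sum>y\<in>U. S (x - y))"
    by (simp add: e_def sum_subtractf sum_distrib_left algebra_simps)
  have "0 \<le> (\<Sum>x\<in>U. \<Sum>y\<in>U. e x y)" by (intro sum_nonneg e_nonneg)
  also note sum_e
  also have "?u * G * (D + 1 - ?u) - D * (\<Sum>x\<in>U. \<Sum>y\<in>U. S (x - y)) \<le> ?u * G * (D + 1 - ?u)"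
    using D S_nonneg by simp
  finally have le: "0 \<le> ?u * G * (D + 1 - ?u)" .
  show "?u \<le> D + 1"
  proof (cases "?u = 0")
    case False
    hence "?u * G > 0" using G by simp
    thus ?thesis using le by (simp add: zero_le_mult_iff)
  qed (use D in simp)
  assume eq: "?u = D + 1" and xy: "x \<in> U" "y \<in> U" "x \<noteq> y"
  \<comment> \<open>When \<open>card U = D + 1\<close> the main term vanishes, so the nonnegative
    gaps add up to at most zero and each of them is zero.\<close>
  have "(\<Sum>x\<in>U. \<Sum>y\<in>U. e x y) \<le> 0"
    unfolding sum_e eq using D S_nonneg by simp
  hence "(\<Sum>x\<in>U. \<Sum>y\<in>U. e x y) = 0"
    using sum_nonneg[of U "\<lambda>x. \<Sum>y\<in>U. e x y"] sum_nonneg[of U "e _"] e_nonneg by (meson order_antisym)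
  hence "(\<Sum>y\<in>U. e x y) = 0"
    using xy(1) fin e_nonneg by (subst (asm) sum_nonneg_eq_0_iff) (auto intro: sum_nonneg)
  hence "e x y = 0"
    using xy(1,2) fin e_nonneg by (subst (asm) sum_nonneg_eq_0_iff) auto
  hence "D * S (x - y) = - G" using xy(3) by (simp add: e_def)
  thus "vec_space.rank n (x - y) = 2"
    using GL_sum_psi_le(2)[OF n hermitian_diff ne[OF xy] rank[OF xy(1,2)]] U xy
    by (auto simp: S_def D_def G_def)
qed

end

section \<open>The integer bound and the translated sets\<close>

theorem theorem4p7:
  fixes q n :: nat and U :: "'a::{field,finite} mat set"
  assumes "primepow q"
    and "CARD('a) = q ^ 2"
    and "n \<ge> 3" and "odd n"
    and "U \<subseteq> hermitian_mats n q"
    and "\<And>x y. x \<in> U \<Longrightarrow> y \<in> U \<Longrightarrow> vec_space.rank n (x - y) \<le> 2"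
  shows "card U \<le> q ^ (2 * n - 1) + q ^ n - q ^ (n - 1)
    \<and> (card U = q ^ (2 * n - 1) + q ^ n - q ^ (n - 1) \<longrightarrow>
        (\<forall>A\<in>U. constant_rank_distance_set n 2 {A - B | B. B \<in> U}))"
proof -
  interpret conj_field q "TYPE('a)"
    using assms(1,2) by unfold_locales
  have n: "n \<ge> 2" using assms(3) by simp
  let ?D = "(real q ^ n - 1) * (real q ^ (n - 1) + 1)"
  \<comment> \<open>Ensures that the subtraction of natural numbers in the bound is not
    truncated.\<close>
  have "q ^ (n - 1) \<le> q ^ n" using q_gt_1 by (intro power_increasing) auto
  hence "real (q ^ (2 * n - 1) + q ^ n - q ^ (n - 1)) = real q ^ (2 * n - 1) + real q ^ n - real q ^ (n - 1)"
    by (simp add: of_nat_diff)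
  also have "real q ^ (2 * n - 1) = real q ^ n * real q ^ (n - 1)"
    using n by (simp add: mult_2 flip: power_add)
  finally have bound: "real (q ^ (2 * n - 1) + q ^ n - q ^ (n - 1)) = ?D + 1"
    by (simp add: algebra_simps)
  note main = hermitian_rank_distance_le_2[OF n assms(4,5,6), folded bound]
  have car: "x \<in> carrier_mat n n" if "x \<in> U" for x
    using that assms(5) hermitian_carrier by blast
  have "constant_rank_distance_set n 2 {A - B | B. B \<in> U}"
    if eq: "card U = q ^ (2 * n - 1) + q ^ n - q ^ (n - 1)" and A: "A \<in> U" for A
  proof -
    have rank2: "vec_space.rank n (x - y) = 2" if "x \<in> U" "y \<in> U" "x \<noteq> y" for x y
      using main(2) eq that by simp
    \<comment> \<open>Differences within the translated set are differences of elements of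
      \<open>U\<close>, and a nonzero \<open>A - B\<close> is itself one; both have rank two in the
      case of equality.\<close>
    have diff: "(A - B) - (A - C) = C - B" if "B \<in> U" "C \<in> U" for B C
      using car[OF A] car[OF that(1)] car[OF that(2)] by (intro eq_matI) auto
    show ?thesis
      unfolding constant_rank_distance_set_def
    proof (intro conjI ballI impI)
      show "{A - B | B. B \<in> U} \<subseteq> carrier_mat n n"
        using minus_carrier_mat[OF car] by auto
    next
      fix X Y assume X: "X \<in> {A - B | B. B \<in> U}" and Y: "Y \<in> {A - B | B. B \<in> U}" and XY: "X \<noteq> Y"
      obtain B C where B: "B \<in> U" "X = A - B" and C: "C \<in> U" "Y = A - C" using X Y by blast
      have "C \<noteq> B" using XY B(2) C(2) by blast
      thus "vec_space.rank n (X - Y) = 2"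
        unfolding B(2) C(2) diff[OF B(1) C(1)] by (rule rank2[OF C(1) B(1)])
    next
      fix X assume X: "X \<in> {A - B | B. B \<in> U}" and X0: "X \<noteq> 0\<^sub>m n n"
      obtain B where B: "B \<in> U" "X = A - B" using X by blast
      have "A \<noteq> B" using X0 B(2) minus_r_inv_mat[OF car[OF A]] by blast
      thus "vec_space.rank n X = 2"
        unfolding B(2) by (rule rank2[OF A B(1)])
    qed
  qed
  moreover have "card U \<le> q ^ (2 * n - 1) + q ^ n - q ^ (n - 1)"
    using main(1) unfolding of_nat_le_iff .
  ultimately show ?thesis by blast
qed

end
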